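(* Let $b>\pi$ and let $V$ be real-valued and absolutely continuous on $[0,b]$. Let $\psi\in L_2(0,b)$ and $g(z)=\int_0^b\xi(x,z)\psi(x)\,dx$ (so $g\in\mathcal B_b$). Define $$\widehat g(z):=\sum_{t\in\operatorname{spec}(H_\pi(\pi/2))}\frac{k_\pi(t,\overline z)}{k_\pi(t,t)}\,g(t),\qquad z\in\mathbb C .$$ Then this series converges for every $z\in\mathbb C$, and for every compact set $K\subset\mathbb C$ there is a constant $D(b,K,V)>0$ (independent of $\psi$) such that $$|g(z)-\widehat g(z)|\le D(b,K,V)\int_\pi^b|\psi(x)|\,dx\qquad\text{for all }z\in K .$$
   Context: $\sqrt{\cdot}$ denotes the principal branch of the square root. For real-valued $V\in L_1(0,s)$ and $z\in\mathbb C$, $\xi(x,z)$ denotes the solution of $-\xi''(x,z)+V(x)\xi(x,z)=z\xi(x,z)$ with $\xi(0,z)=1$, $\xi'(0,z)=0$ (primes denote $\partial_x$); it is real entire in $z$. For $s>0$ and $\gamma\in[0,\pi)$, $H_s(\gamma)$ is the selfadjoint operator in $L_2(0,s)$ acting as $\tau=-\frac{d^2}{dx^2}+V$ on $\{\varphi\in L_2(0,s):\varphi,\varphi'\text{ absolutely continuous},\ \tau\varphi\in L_2(0,s),\ \varphi'(0)=0,\ \varphi(s)\cos\gamma+\varphi'(s)\sin\gamma=0\}$; its spectrum consists of simple real eigenvalues (for $\gamma=\pi/2$ these are the $\lambda$ with $\xi'(s,\lambda)=0$). $\mathcal B_s$ is the de Branges space of entire functions $f(z)=\int_0^s\xi(x,z)\varphi(x)\,dx$,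 $\varphi\in L_2(0,s)$, with norm $\|f\|=\|\varphi\|_{L_2(0,s)}$; its reproducing kernel is $k_s(z,w)=\int_0^s\xi(x,z)\overline{\xi(x,w)}\,dx$, so that for real $t$, $k_s(t,\overline z)=\int_0^s\xi(x,t)\xi(x,z)\,dx$. *)

theory Defs
  imports "HOL-Analysis.Analysis"
begin

definition abs_continuous_on :: "real \<Rightarrow> real \<Rightarrow> (real \<Rightarrow> real) \<Rightarrow> bool" where
  "abs_continuous_on a c V \<longleftrightarrow>
     (\<forall>\<epsilon>>0. \<exists>\<delta>>0. \<forall>(n::nat) (l::nat \<Rightarrow> real) (r::nat \<Rightarrow> real).
        (\<forall>i<n. a \<le> l i \<and> l i \<le> r i \<and> r i \<le> c) \<and>
        (\<forall>i j. i < j \<and> j < n \<longrightarrow> r i \<le> l j) \<and>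
        (\<Sum>i<n. r i - l i) < \<delta>
        \<longrightarrow> (\<Sum>i<n. \<bar>V (r i) - V (l i)\<bar>) < \<epsilon>)"

definition L2_on :: "real \<Rightarrow> real \<Rightarrow> (real \<Rightarrow> complex) \<Rightarrow> bool" where
  "L2_on a c \<psi> \<longleftrightarrow> \<psi> measurable_on {a..c} \<and> (\<lambda>x. (norm (\<psi> x))^2) integrable_on {a..c}"

text \<open>Spectrum of H_s(pi/2): the (real) zeros of xi'(s, .).\<close>
definition spec_neumann :: "(complex \<Rightarrow> real \<Rightarrow> complex) \<Rightarrow> real \<Rightarrow> real set" where
  "spec_neumann \<xi>' s = {t::real. \<xi>' (complex_of_real t) s = 0}"

text \<open>Reproducing kernel k_s(z,w) of B_s, for w given via its conjugate:
  kernel_conj xi s t z = k_s(t, conj z) = int_0^s xi(x,t) xi(x,z) dx.\<close>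
definition kernel_conj :: "(complex \<Rightarrow> real \<Rightarrow> complex) \<Rightarrow> real \<Rightarrow> complex \<Rightarrow> complex \<Rightarrow> complex" where
  "kernel_conj \<xi> s w z = integral {0..s} (\<lambda>x. \<xi> w x * \<xi> z x)"

definition sampling_partial ::
  "(complex \<Rightarrow> real \<Rightarrow> complex) \<Rightarrow> (complex \<Rightarrow> real \<Rightarrow> complex) \<Rightarrow> (complex \<Rightarrow> complex)
     \<Rightarrow> complex \<Rightarrow> real \<Rightarrow> complex" where
  "sampling_partial \<xi> \<xi>' g z T =
     (\<Sum>t\<in>{t\<in>spec_neumann \<xi>' pi. t \<le> T}.
        kernel_conj \<xi> pi (complex_of_real t) z / kernel_conj \<xi> pi (complex_of_real t) (complex_of_real t)
        * g (complex_of_real t))"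

end

theory Submission
  imports Defs
begin

text \<open>
  By the Lagrange identity \<open>k\<^sub>\<pi>(t, cnj z) = \<xi>(\<pi>,t) \<xi>'(\<pi>,z) / (t - z)\<close> for an eigenvalue \<open>t\<close>, so the
  coefficients of the sampling series decay like \<open>1/t\<close>. The sum of the \<open>1/t\<close> is finite: apply
  Bessel's inequality for the form \<open>\<integral> f' g' + W f g\<close> (with \<open>W = V + c \<ge> 1\<close>) to the solution
  \<open>\<xi>(\<cdot>, -c)\<close>, using that eigenfunctions are uniformly bounded and uniformly non-zero at \<open>\<pi>\<close> by an
  energy estimate. Hence \<open>\<Sum>\<^sub>t k\<^sub>\<pi>(t, cnj z)/k\<^sub>\<pi>(t,t) \<xi>(x,t)\<close> converges absolutely and uniformly for
  \<open>x \<in> [0,b]\<close>; on \<open>[0,\<pi>]\<close> its sum is \<open>\<xi>(x,z)\<close> because the eigenfunctions are complete. Integrating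
  against \<open>\<psi>\<close>, only the part of \<open>\<psi>\<close> on \<open>[\<pi>,b]\<close> contributes to \<open>g\<close> minus the sampling series.

  Completeness is proved without compactness. If \<open>\<delta> \<noteq> 0\<close> were orthogonal to all eigenfunctions, then
  for the Green operator \<open>G\<close> the ratios \<open>\<parallel>G\<^sup>n\<^sup>+\<^sup>1 \<delta>\<parallel> / \<parallel>G\<^sup>n \<delta>\<parallel>\<close> would increase to some \<open>l > 0\<close> and the
  normalised \<open>G\<^sup>n \<delta>\<close> would be approximate eigenvectors of \<open>G\<close> for \<open>l\<close>. But the initial value problem
  shows that the resolvent at any real point is bounded on the orthogonal complement of the
  eigenfunctions.
\<close>

subsection \<open>Estimates for integrals and linear second-order equations\<close>

lemma nonincreasing_within:
  fixes F F' :: "real \<Rightarrow> real"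
  assumes "\<And>x. x \<in> {0..L} \<Longrightarrow> (F has_real_derivative F' x) (at x within {0..L})"
    and "\<And>x. x \<in> {0..L} \<Longrightarrow> F' x \<le> 0" and "x \<in> {0..L}"
  shows "F x \<le> F 0"
proof -
  have "\<exists>s\<in>{0..x}. F x - F 0 = F' s * (x - 0)"
  proof (rule mvt_very_simple)
    fix s assume "0 \<le> s" "s \<le> x"
    then have "(F has_real_derivative F' s) (at s within {0..x})"
      using assms(1)[of s] assms(3) by (auto intro: DERIV_subset)
    then show "(F has_derivative (*) (F' s)) (at s within {0..x})"
      by (simp add: has_field_derivative_def)
  qed (use assms(3) in auto)
  then obtain s where "s \<in> {0..x}" "F x - F 0 = F' s * x" by auto
  moreover have "F' s * x \<le> 0"
    using assms(2)[of s] assms(3) \<open>s \<in> {0..x}\<close> by (intro mult_nonpos_nonneg) auto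
  ultimately show ?thesis by linarith
qed

text \<open>For \<open>e = |q|^2 + |q'|^2\<close>, Cauchy-Schwarz and Young give
  \<open>e' <= K e + h^2\<close> with \<open>K = A + 2\<close>, so \<open>exp (- K s) * e s\<close>
  minus the integral of \<open>h^2\<close> is nonincreasing. The forcing enters squared, so that it
  is controlled by its L2 norm.\<close>

lemma gronwall_energy:
  fixes q q' r :: "real \<Rightarrow> 'a::real_inner"
  assumes q: "\<And>x. x \<in> {0..L} \<Longrightarrow> (q has_vector_derivative q' x) (at x within {0..L})"
    and q': "\<And>x. x \<in> {0..L} \<Longrightarrow> (q' has_vector_derivative r x) (at x within {0..L})"
    and r: "\<And>x. x \<in> {0..L} \<Longrightarrow> norm (r x) \<le> A * norm (q x) + h x"
    and A: "A \<ge> 0" and h: "continuous_on {0..L} h" and x: "x \<in> {0..L}"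
  shows "(norm (q x))\<^sup>2 + (norm (q' x))\<^sup>2
     \<le> exp ((A + 2) * x) * ((norm (q 0))\<^sup>2 + (norm (q' 0))\<^sup>2 + integral {0..x} (\<lambda>s. (h s)\<^sup>2))"
proof -
  define K where "K = A + 2"
  define e where "e = (\<lambda>s. q s \<bullet> q s + q' s \<bullet> q' s)"
  define I where "I = (\<lambda>s. integral {0..s} (\<lambda>s. (h s)\<^sup>2))"
  define F where "F = (\<lambda>s. exp (- K * s) * e s - I s)"
  have e: "(e has_real_derivative (2 * (q s \<bullet> q' s) + 2 * (q' s \<bullet> r s))) (at s within {0..L})"
    if "s \<in> {0..L}" for s
    using has_derivative_inner[OF q[OF that, unfolded has_vector_derivative_def]
                                  q[OF that, unfolded has_vector_derivative_def]]
      has_derivative_inner[OF q'[OF that, unfolded has_vector_derivative_def]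
                                  q'[OF that, unfolded has_vector_derivative_def]]
    unfolding e_def has_field_derivative_def
    by (auto intro!: has_derivative_eq_rhs[OF has_derivative_add] simp: fun_eq_iff inner_commute algebra_simps)
  have e_bd: "2 * (q s \<bullet> q' s) + 2 * (q' s \<bullet> r s) \<le> K * e s + (h s)\<^sup>2" if s: "s \<in> {0..L}" for s
  proof -
    let ?a = "norm (q s)" and ?b = "norm (q' s)"
    have "q s \<bullet> q' s \<le> ?a * ?b" by (rule norm_cauchy_schwarz)
    moreover have "q' s \<bullet> r s \<le> ?b * (A * ?a + h s)"
      by (rule order_trans[OF norm_cauchy_schwarz]) (intro mult_left_mono r s; simp)
    moreover have "0 \<le> (1 + A) * (?a - ?b)\<^sup>2" "0 \<le> (?b - h s)\<^sup>2"
      using A by simp_all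
    ultimately have "2 * (q s \<bullet> q' s) + 2 * (q' s \<bullet> r s) \<le> (1 + A) * (?a\<^sup>2 + ?b\<^sup>2) + ?b\<^sup>2 + (h s)\<^sup>2"
      by (simp add: algebra_simps power2_eq_square)
    also have "\<dots> \<le> K * (?a\<^sup>2 + ?b\<^sup>2) + (h s)\<^sup>2"
      by (simp add: K_def algebra_simps)
    also have "?a\<^sup>2 + ?b\<^sup>2 = e s" by (simp add: e_def power2_norm_eq_inner)
    finally show ?thesis .
  qed
  have "F x \<le> F 0"
  proof (rule nonincreasing_within[OF _ _ x])
    fix s assume s: "s \<in> {0..L}"
    have "(I has_vector_derivative (h s)\<^sup>2) (at s within {0..L})"
      unfolding I_def using s by (intro integral_has_vector_derivative continuous_intros h)
    then have I': "(I has_real_derivative (h s)\<^sup>2) (at s within {0..L})"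
      by (simp add: has_real_derivative_iff_has_vector_derivative)
    show "(F has_real_derivative exp (- K * s) * (2 * (q s \<bullet> q' s) + 2 * (q' s \<bullet> r s) - K * e s) - (h s)\<^sup>2)
       (at s within {0..L})"
      unfolding F_def
      by (rule derivative_eq_intros e[OF s] I' refl)+ (simp add: algebra_simps)
    have "exp (- K * s) * (2 * (q s \<bullet> q' s) + 2 * (q' s \<bullet> r s) - K * e s) \<le> exp (- K * s) * (h s)\<^sup>2"
      using e_bd[OF s] by (intro mult_left_mono) auto
    also have "\<dots> \<le> 1 * (h s)\<^sup>2"
      using A s by (intro mult_right_mono) (auto simp: K_def intro: mult_nonpos_nonneg)
    finally show "exp (- K * s) * (2 * (q s \<bullet> q' s) + 2 * (q' s \<bullet> r s) - K * e s) - (h s)\<^sup>2 \<le> 0"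
      by simp
  qed
  then have "exp (- K * x) * e x \<le> e 0 + I x"
    by (simp add: F_def I_def)
  then have "exp (K * x) * (exp (- K * x) * e x) \<le> exp (K * x) * (e 0 + I x)"
    by (intro mult_left_mono) auto
  also have "exp (K * x) * (exp (- K * x) * e x) = e x"
    by (metis exp_minus_inverse mult.assoc mult_1 mult_minus_left)
  finally show ?thesis
    by (simp add: K_def e_def I_def power2_norm_eq_inner)
qed

lemma integral_Cauchy_Schwarz:
  fixes f g :: "real \<Rightarrow> real"
  assumes f: "continuous_on {a..b} f" and g: "continuous_on {a..b} g"
  shows "(integral {a..b} (\<lambda>x. f x * g x))\<^sup>2
     \<le> integral {a..b} (\<lambda>x. (f x)\<^sup>2) * integral {a..b} (\<lambda>x. (g x)\<^sup>2)"
proof -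
  define A B C where "A = integral {a..b} (\<lambda>x. (f x)\<^sup>2)" "B = integral {a..b} (\<lambda>x. f x * g x)"
    "C = integral {a..b} (\<lambda>x. (g x)\<^sup>2)"
  have int: "(\<lambda>x. (f x)\<^sup>2) integrable_on {a..b}" "(\<lambda>x. f x * g x) integrable_on {a..b}"
    "(\<lambda>x. (g x)\<^sup>2) integrable_on {a..b}"
    by (intro integrable_continuous_real continuous_intros f g)+
  have q: "0 \<le> \<alpha>\<^sup>2 * A - 2 * \<alpha> * \<beta> * B + \<beta>\<^sup>2 * C" for \<alpha> \<beta>
  proof -
    have "((\<lambda>x. \<alpha>\<^sup>2 * (f x)\<^sup>2 - 2 * \<alpha> * \<beta> * (f x * g x) + \<beta>\<^sup>2 * (g x)\<^sup>2) has_integral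
       (\<alpha>\<^sup>2 * A - 2 * \<alpha> * \<beta> * B + \<beta>\<^sup>2 * C)) {a..b}"
      unfolding A_B_C_def
      by (intro has_integral_add has_integral_diff has_integral_mult_right integrable_integral int)
    moreover have "\<alpha>\<^sup>2 * (f x)\<^sup>2 - 2 * \<alpha> * \<beta> * (f x * g x) + \<beta>\<^sup>2 * (g x)\<^sup>2 = (\<alpha> * f x - \<beta> * g x)\<^sup>2" for x
      by (simp add: power2_eq_square algebra_simps)
    ultimately show ?thesis
      by (metis (no_types, lifting) has_integral_nonneg zero_le_power2)
  qed
  have "0 \<le> C" using q[of 0 1] by simp
  have "B\<^sup>2 \<le> A * C"
  proof (cases "C = 0")
    case True
    have "B = 0"
    proof (rule ccontr)
      assume "B \<noteq> 0"
      \<comment> \<open>With \<open>C = 0\<close> the form is affine in \<beta>; this \<beta> gives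
        it the value \<open>A - (A + 1) = -1\<close>.\<close>
      then show False using q[of 1 "(A + 1) / (2 * B)"] True by (simp add: field_simps)
    qed
    then show ?thesis using True by simp
  next
    case False
    with \<open>0 \<le> C\<close> have "C > 0" by simp
    \<comment> \<open>The form at \<open>(C, B)\<close>, near its minimum direction, equals exactly
      this product.\<close>
    have "0 \<le> C * (A * C - B\<^sup>2)"
      using q[of C B] by (simp add: power2_eq_square algebra_simps)
    with \<open>C > 0\<close> show ?thesis by (simp add: zero_le_mult_iff)
  qed
  then show ?thesis by (simp add: A_B_C_def)
qed

lemma integral_square_add:
  fixes f g :: "real \<Rightarrow> real"
  assumes f: "continuous_on {a..b} f" and g: "continuous_on {a..b} g"
  shows "integral {a..b} (\<lambda>x. (f x + r * g x)\<^sup>2) = integral {a..b} (\<lambda>x. (f x)\<^sup>2)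
     + 2 * r * integral {a..b} (\<lambda>x. f x * g x) + r\<^sup>2 * integral {a..b} (\<lambda>x. (g x)\<^sup>2)"
proof (rule integral_unique)
  have "((\<lambda>x. (f x)\<^sup>2 + 2 * r * (f x * g x) + r\<^sup>2 * (g x)\<^sup>2) has_integral
      (integral {a..b} (\<lambda>x. (f x)\<^sup>2)
     + 2 * r * integral {a..b} (\<lambda>x. f x * g x) + r\<^sup>2 * integral {a..b} (\<lambda>x. (g x)\<^sup>2))) {a..b}"
    by (intro has_integral_add has_integral_mult_right integrable_integral
        integrable_continuous_real continuous_intros f g)
  then show "((\<lambda>x. (f x + r * g x)\<^sup>2) has_integral (integral {a..b} (\<lambda>x. (f x)\<^sup>2)
     + 2 * r * integral {a..b} (\<lambda>x. f x * g x) + r\<^sup>2 * integral {a..b} (\<lambda>x. (g x)\<^sup>2))) {a..b}"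
    by (simp add: power2_eq_square algebra_simps)
qed

lemma abs_continuous_on_imp_continuous_on:
  assumes "abs_continuous_on a c V"
  shows "continuous_on {a..c} V"
proof (rule continuous_on_iff[THEN iffD2], intro ballI allI impI)
  fix x e :: real assume x: "x \<in> {a..c}" and "e > 0"
  then obtain d where "d > 0" and d: "\<And>(n::nat) (l::nat \<Rightarrow> real) (r::nat \<Rightarrow> real).
        (\<forall>i<n. a \<le> l i \<and> l i \<le> r i \<and> r i \<le> c) \<and>
        (\<forall>i j. i < j \<and> j < n \<longrightarrow> r i \<le> l j) \<and>
        (\<Sum>i<n. r i - l i) < d
        \<Longrightarrow> (\<Sum>i<n. \<bar>V (r i) - V (l i)\<bar>) < e"
    using assms[unfolded abs_continuous_on_def, rule_format, OF \<open>e > 0\<close>] by blast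
  show "\<exists>d>0. \<forall>x'\<in>{a..c}. dist x' x < d \<longrightarrow> dist (V x') (V x) < e"
  proof (intro exI[of _ d] conjI ballI impI)
    fix y assume "y \<in> {a..c}" "dist y x < d"
    then show "dist (V y) (V x) < e"
      \<comment> \<open>A family with one interval, the one between \<open>x\<close> and
        \<open>y\<close>.\<close>
      using d[of "Suc 0" "\<lambda>_. min x y" "\<lambda>_. max x y"] x
      by (cases "x \<le> y") (auto simp: dist_real_def max_def min_def abs_minus_commute)
  qed fact
qed

lemma integral_square_eq_0:
  fixes f :: "real \<Rightarrow> real"
  assumes "a < c" "continuous_on {a..c} f" "integral {a..c} (\<lambda>x. (f x)\<^sup>2) = 0" "x \<in> {a..c}"
  shows "f x = 0"
proof -
  have "((\<lambda>x. (f x)\<^sup>2) has_integral 0) (cbox a c)"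
    using integrable_integral[of "\<lambda>x. (f x)\<^sup>2" "{a..c}"] assms
    by (auto intro!: integrable_continuous_real continuous_intros)
  then have "(f x)\<^sup>2 = 0"
    by (rule has_integral_0_cbox_imp_0[rotated 2])
      (use assms in \<open>auto intro!: continuous_intros simp: not_le\<close>)
  then show ?thesis by simp
qed

text \<open>On a bounded interval L2 lies in L1, because \<open>1 + |\<psi>|^2\<close> dominates
  \<open>|\<psi>|\<close>.\<close>

lemma L2_on_absolutely_integrable:
  assumes "L2_on a c \<psi>"
  shows "\<psi> absolutely_integrable_on {a..c}"
proof (rule measurable_bounded_by_integrable_imp_absolutely_integrable)
  show "\<psi> \<in> borel_measurable (lebesgue_on {a..c})"
    using assms by (simp add: L2_on_def measurable_on_iff_borel_measurable)
  show "(\<lambda>x. 1 + (norm (\<psi> x))\<^sup>2) integrable_on {a..c}"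
    using assms by (intro integrable_add integrable_const_ivl) (simp add: L2_on_def)
  show "norm (\<psi> x) \<le> 1 + (norm (\<psi> x))\<^sup>2" for x
    using sum_squares_bound[of 1 "norm (\<psi> x)"] norm_ge_zero[of "\<psi> x"] unfolding power_one by linarith
qed simp

lemma continuous_times_absolutely_integrable:
  fixes q \<psi> :: "real \<Rightarrow> complex"
  assumes "continuous_on {a..c} q" "\<psi> absolutely_integrable_on {a..c}"
  shows "(\<lambda>x. q x * \<psi> x) absolutely_integrable_on {a..c}"
  using assms
  by (intro absolutely_integrable_bounded_measurable_product[of "(*)"])
    (auto intro!: continuous_imp_measurable_on_sets_lebesgue compact_imp_bounded compact_continuous_image
      simp: bilinear_conv_bounded_bilinear bounded_bilinear_mult)

lemma norm_integral_times_le: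
  fixes q \<psi> :: "real \<Rightarrow> complex"
  assumes "continuous_on {a..c} q" "\<psi> absolutely_integrable_on {a..c}"
    and "\<And>x. x \<in> {a..c} \<Longrightarrow> norm (q x) \<le> K"
  shows "norm (integral {a..c} (\<lambda>x. q x * \<psi> x)) \<le> K * integral {a..c} (\<lambda>x. norm (\<psi> x))"
proof -
  have "norm (integral {a..c} (\<lambda>x. q x * \<psi> x)) \<le> integral {a..c} (\<lambda>x. K * norm (\<psi> x))"
    using continuous_times_absolutely_integrable[OF assms(1,2)] assms(2,3)
    by (intro Henstock_Kurzweil_Integration.integral_norm_bound_integral)
      (auto simp: absolutely_integrable_on_def norm_mult mult_right_mono intro!: integrable_on_mult_right)
  then show ?thesis by simp
qed

text \<open>Splits complex orthogonality relations into real ones, the form in which completeness is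
  proved.\<close>

lemma Im_Re_integral_zero:
  fixes f :: "real \<Rightarrow> complex"
  assumes "continuous_on {a..c} f" "integral {a..c} f = 0"
  shows "integral {a..c} (\<lambda>x. Re (f x)) = 0" "integral {a..c} (\<lambda>x. Im (f x)) = 0"
  using integral_linear[OF integrable_continuous_real[OF assms(1)] bounded_linear_Re]
    integral_linear[OF integrable_continuous_real[OF assms(1)] bounded_linear_Im] assms(2)
  by (simp_all add: o_def)

subsection \<open>Neumann eigenfunctions\<close>

text \<open>The potential is \<open>V = W - c\<close>; the shift by \<open>c\<close> makes the form of \<open>W\<close> positive definite.\<close>

locale neumann_problem =
  fixes b c B :: real and W :: "real \<Rightarrow> real" and \<xi> \<xi>' :: "complex \<Rightarrow> real \<Rightarrow> complex"
  assumes b: "pi < b"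
    and W_cont: "continuous_on {0..b} W"
    and W_ge: "\<And>x. x \<in> {0..b} \<Longrightarrow> 1 \<le> W x"
    and W_le: "\<And>x. x \<in> {0..b} \<Longrightarrow> W x \<le> B"
    and xi0: "\<And>z. \<xi> z 0 = 1"
    and xi'0: "\<And>z. \<xi>' z 0 = 0"
    and xi_deriv: "\<And>z x. x \<in> {0..b} \<Longrightarrow> (\<xi> z has_vector_derivative \<xi>' z x) (at x within {0..b})"
    and xi'_deriv: "\<And>z x. x \<in> {0..b} \<Longrightarrow>
         (\<xi>' z has_vector_derivative ((of_real (W x) - (z + of_real c)) * \<xi> z x)) (at x within {0..b})"
begin

text \<open>For real \<open>t\<close> the solution is real (\<open>xi_real\<close>), so
  \<open>u t\<close> and \<open>u' t\<close> carry all of it. \<open>k t\<close> is the diagonal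
  kernel value \<open>k_pi(t,t)\<close>, see \<open>kernel_diag\<close>.\<close>

definition "u t x = Re (\<xi> (of_real t) x)"
definition "u' t x = Re (\<xi>' (of_real t) x)"
definition "k t = integral {0..pi} (\<lambda>x. (u t x)\<^sup>2)"
definition "S = spec_neumann \<xi>' pi"

lemma B_ge: "1 \<le> B"
  using W_ge[of 0] W_le[of 0] b pi_gt_zero by (auto intro: order_trans)

lemma b_pos: "0 < b"
  using b pi_gt_zero by linarith

lemma in_b: "x \<in> {0..pi} \<Longrightarrow> x \<in> {0..b}"
  using b by auto

lemma xi_cont: "continuous_on {0..b} (\<xi> z)" "continuous_on {0..b} (\<xi>' z)"
  by (rule continuous_on_vector_derivative, erule xi_deriv, rule continuous_on_vector_derivative, erule xi'_deriv)

text \<open>\<open>gronwall_energy\<close> with \<open>h = 0\<close>. Only a bound \<open>R\<close>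
  on the shifted parameter enters, so the estimate is uniform for \<open>z\<close> in a compact
  set.\<close>

lemma xi_bound:
  assumes x: "x \<in> {0..b}" and R: "cmod (z + of_real c) \<le> R"
  shows "cmod (\<xi> z x) \<le> exp ((B + R + 2) * b)" "cmod (\<xi>' z x) \<le> exp ((B + R + 2) * b)"
proof -
  have R0: "0 \<le> R" using R norm_ge_zero order_trans by blast
  let ?E = "exp ((B + R + 2) * b)"
  have "(norm (\<xi> z x))\<^sup>2 + (norm (\<xi>' z x))\<^sup>2
     \<le> exp ((B + R + 2) * x) * ((norm (\<xi> z 0))\<^sup>2 + (norm (\<xi>' z 0))\<^sup>2 + integral {0..x} (\<lambda>s. 0\<^sup>2))"
  proof (rule gronwall_energy[OF xi_deriv xi'_deriv _ _ _ x])
    fix y assume y: "y \<in> {0..b}"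
    have "cmod (of_real (W y) - (z + of_real c)) \<le> B + R"
      using norm_triangle_ineq4[of "of_real (W y)" "z + of_real c"] R W_ge[OF y] W_le[OF y] by simp
    then show "cmod ((of_real (W y) - (z + of_real c)) * \<xi> z y) \<le> (B + R) * cmod (\<xi> z y) + 0"
      by (simp add: norm_mult mult_right_mono)
  qed (use B_ge R0 in auto)
  also have "\<dots> \<le> ?E"
    using x B_ge R0 by (auto simp: xi0 xi'0 intro: mult_left_mono)
  \<comment> \<open>The exponent is nonnegative, so \<open>?E\<close> is at least 1; this avoids
    taking a root.\<close>
  also have "\<dots> \<le> ?E\<^sup>2"
    using B_ge R0 b_pos by (simp add: power2_eq_square)
  finally have "(norm (\<xi> z x))\<^sup>2 \<le> ?E\<^sup>2" "(norm (\<xi>' z x))\<^sup>2 \<le> ?E\<^sup>2"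
    by (smt (verit) zero_le_power2)+
  then show "cmod (\<xi> z x) \<le> ?E" "cmod (\<xi>' z x) \<le> ?E"
    by (auto intro: power2_le_imp_le)
qed

text \<open>The imaginary part solves the same real equation with zero initial data, so
  \<open>gronwall_energy\<close> makes it vanish.\<close>

lemma xi_real:
  assumes x: "x \<in> {0..b}"
  shows "\<xi> (of_real t) x = of_real (u t x)" "\<xi>' (of_real t) x = of_real (u' t x)"
proof -
  let ?q = "\<lambda>x. Im (\<xi> (of_real t) x)" and ?q' = "\<lambda>x. Im (\<xi>' (of_real t) x)"
  have "(norm (?q x))\<^sup>2 + (norm (?q' x))\<^sup>2
     \<le> exp ((B + \<bar>t + c\<bar> + 2) * x) * ((norm (?q 0))\<^sup>2 + (norm (?q' 0))\<^sup>2 + integral {0..x} (\<lambda>s. 0\<^sup>2))"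
  proof (rule gronwall_energy[OF _ _ _ _ _ x])
    fix y assume y: "y \<in> {0..b}"
    show "(?q has_vector_derivative ?q' y) (at y within {0..b})"
      by (rule bounded_linear.has_vector_derivative[OF bounded_linear_Im xi_deriv[OF y]])
    show "(?q' has_vector_derivative (W y - (t + c)) * ?q y) (at y within {0..b})"
      using bounded_linear.has_vector_derivative[OF bounded_linear_Im xi'_deriv[OF y, of "of_real t"]]
      by simp
    have "\<bar>W y - (t + c)\<bar> \<le> B + \<bar>t + c\<bar>"
      using W_ge[OF y] W_le[OF y] by simp
    then show "norm ((W y - (t + c)) * ?q y) \<le> (B + \<bar>t + c\<bar>) * norm (?q y) + 0"
      by (simp add: abs_mult mult_right_mono)
  qed (use B_ge in auto)
  then have "?q x = 0" "?q' x = 0"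
    by (auto simp: xi0 xi'0 sum_power2_le_zero_iff)
  then show "\<xi> (of_real t) x = of_real (u t x)" "\<xi>' (of_real t) x = of_real (u' t x)"
    by (auto simp: u_def u'_def complex_eq_iff)
qed

lemma u0 [simp]: "u t 0 = 1" "u' t 0 = 0"
  by (simp_all add: u_def u'_def xi0 xi'0)

lemma S_iff: "t \<in> S \<longleftrightarrow> u' t pi = 0"
  using b pi_gt_zero by (simp add: S_def spec_neumann_def xi_real)

lemma u_deriv_b:
  assumes "x \<in> {0..b}"
  shows "(u t has_real_derivative u' t x) (at x within {0..b})"
    "(u' t has_real_derivative ((W x - (t + c)) * u t x)) (at x within {0..b})"
  using bounded_linear.has_vector_derivative[OF bounded_linear_Re xi_deriv[OF assms, of "of_real t"]]
    bounded_linear.has_vector_derivative[OF bounded_linear_Re xi'_deriv[OF assms, of "of_real t"]]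
  by (simp_all add: has_real_derivative_iff_has_vector_derivative u_def[abs_def] u'_def[abs_def])

lemma u_deriv:
  assumes "x \<in> {0..pi}"
  shows "(u t has_real_derivative u' t x) (at x within {0..pi})"
    "(u' t has_real_derivative ((W x - (t + c)) * u t x)) (at x within {0..pi})"
  by (rule DERIV_subset[OF u_deriv_b(1)[OF in_b[OF assms]]], use b in force)
    (rule DERIV_subset[OF u_deriv_b(2)[OF in_b[OF assms]]], use b in force)

lemma cont: "continuous_on {0..pi} (u t)" "continuous_on {0..pi} (u' t)" "continuous_on {0..pi} W"
  using continuous_on_subset[OF W_cont, of "{0..pi}"] b
  by (auto intro: DERIV_continuous_on u_deriv)

lemma FTC:
  assumes "\<And>x. x \<in> {0..pi} \<Longrightarrow> (F has_real_derivative F' x) (at x within {0..pi})"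
  shows "(F' has_integral (F pi - F 0)) {0..pi}"
  using assms by (intro fundamental_theorem_of_calculus)
    (auto simp: has_real_derivative_iff_has_vector_derivative)

text \<open>The weight \<open>t + c\<close> cancels the spectral parameter in \<open>E'\<close>,
  leaving \<open>2 W u u'\<close>, which is at most \<open>B * E\<close> in modulus. The growth rate
  is therefore independent of \<open>t\<close>, and both bounds are uniform in \<open>t\<close>
  relative to \<open>E 0 = t + c\<close>.\<close>

lemma energy_bounds:
  assumes t: "1 \<le> t + c" and x: "x \<in> {0..b}"
  defines "E \<equiv> \<lambda>x. (u' t x)\<^sup>2 + (t + c) * (u t x)\<^sup>2"
  shows "E x \<le> (t + c) * exp (B * b)" "(t + c) * exp (- (B * b)) \<le> E x"
proof -
  let ?d = "\<lambda>x. 2 * W x * (u t x * u' t x)"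
  have E: "(E has_real_derivative ?d x) (at x within {0..b})" if x: "x \<in> {0..b}" for x
    unfolding E_def
    by (rule derivative_eq_intros u_deriv_b[OF x] refl)+ (simp add: algebra_simps)
  have bd: "\<bar>?d y\<bar> \<le> B * E y" if y: "y \<in> {0..b}" for y
  proof -
    have "\<bar>?d y\<bar> = W y * (2 * \<bar>u t y\<bar> * \<bar>u' t y\<bar>)"
      using W_ge[OF y] by (simp add: abs_mult)
    also have "\<dots> \<le> B * (2 * \<bar>u t y\<bar> * \<bar>u' t y\<bar>)"
      using W_le[OF y] by (intro mult_right_mono) auto
    also have "2 * \<bar>u t y\<bar> * \<bar>u' t y\<bar> \<le> (u t y)\<^sup>2 + (u' t y)\<^sup>2"
      using sum_squares_bound[of "\<bar>u t y\<bar>" "\<bar>u' t y\<bar>"] by simp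
    also have "\<dots> \<le> E y"
      using mult_right_mono[OF t, of "(u t y)\<^sup>2"] by (simp add: E_def)
    finally show ?thesis using B_ge by simp
  qed
  have E0: "E 0 = t + c" by (simp add: E_def)
  have "exp (- B * x) * E x \<le> exp (- B * 0) * E 0"
  proof (rule nonincreasing_within[OF _ _ x])
    fix s assume s: "s \<in> {0..b}"
    show "((\<lambda>x. exp (- B * x) * E x) has_real_derivative exp (- B * s) * (?d s - B * E s)) (at s within {0..b})"
      by (rule derivative_eq_intros E[OF s] refl)+ (simp add: algebra_simps)
    show "exp (- B * s) * (?d s - B * E s) \<le> 0"
      using bd[OF s] by (intro mult_nonneg_nonpos) auto
  qed
  then have "exp (B * x) * (exp (- B * x) * E x) \<le> exp (B * x) * (t + c)"
    using E0 by (intro mult_left_mono) auto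
  also have "exp (B * x) * (exp (- B * x) * E x) = E x" by (simp add: exp_minus)
  also have "exp (B * x) * (t + c) \<le> exp (B * b) * (t + c)"
    using x B_ge t by (intro mult_right_mono) auto
  finally show "E x \<le> (t + c) * exp (B * b)" by (simp add: mult.commute)
  have "- (exp (B * x) * E x) \<le> - (exp (B * 0) * E 0)"
  proof (rule nonincreasing_within[OF _ _ x])
    fix s assume s: "s \<in> {0..b}"
    show "((\<lambda>x. - (exp (B * x) * E x)) has_real_derivative exp (B * s) * (- ?d s - B * E s)) (at s within {0..b})"
      by (rule derivative_eq_intros E[OF s] refl)+ (simp add: algebra_simps)
    show "exp (B * s) * (- ?d s - B * E s) \<le> 0"
      using bd[OF s] by (intro mult_nonneg_nonpos) auto
  qed
  then have "exp (- (B * x)) * (t + c) \<le> exp (- (B * x)) * (exp (B * x) * E x)"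
    using E0 by (intro mult_left_mono) auto
  also have "exp (- (B * x)) * (exp (B * x) * E x) = E x" by (simp add: exp_minus)
  finally have "exp (- (B * x)) * (t + c) \<le> E x" .
  moreover have "exp (- (B * b)) * (t + c) \<le> exp (- (B * x)) * (t + c)"
    using x B_ge t by (intro mult_right_mono) auto
  ultimately show "(t + c) * exp (- (B * b)) \<le> E x" by (simp add: mult.commute)
qed

section \<open>The Neumann problem with a right-hand side\<close>

text \<open>The graph of the Green operator \<open>G\<close> of \<open>- d^2/dx^2 + W\<close> with
  Neumann conditions at 0 and \<open>pi\<close>: \<open>y = G f\<close>. A relation carrying the
  derivative \<open>y'\<close> allows its properties to be stated before existence is known.\<close>

definition neumann_sol :: "(real \<Rightarrow> real) \<Rightarrow> (real \<Rightarrow> real) \<Rightarrow> (real \<Rightarrow> real) \<Rightarrow> bool" where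
  "neumann_sol y y' f \<longleftrightarrow> continuous_on {0..pi} f \<and> y' 0 = 0 \<and> y' pi = 0 \<and>
     (\<forall>x\<in>{0..pi}. (y has_real_derivative y' x) (at x within {0..pi}) \<and>
        (y' has_real_derivative (W x * y x - f x)) (at x within {0..pi}))"

lemma neumann_solD:
  assumes "neumann_sol y y' f"
  shows "continuous_on {0..pi} f" "continuous_on {0..pi} y" "continuous_on {0..pi} y'"
    "y' 0 = 0" "y' pi = 0"
    "\<And>x. x \<in> {0..pi} \<Longrightarrow> (y has_real_derivative y' x) (at x within {0..pi})"
    "\<And>x. x \<in> {0..pi} \<Longrightarrow> (y' has_real_derivative (W x * y x - f x)) (at x within {0..pi})"
  using assms unfolding neumann_sol_def by (auto intro!: DERIV_continuous_on)

text \<open>Symmetry of \<open>G\<close>: the Wronskian \<open>y w' - y' w\<close> vanishes at both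
  ends and has derivative \<open>f w - y g\<close>.\<close>

lemma neumann_sol_symmetric:
  assumes "neumann_sol y y' f" "neumann_sol w w' g"
  shows "integral {0..pi} (\<lambda>x. y x * g x) = integral {0..pi} (\<lambda>x. f x * w x)"
proof -
  note y = neumann_solD[OF assms(1)] and w = neumann_solD[OF assms(2)]
  have "((\<lambda>x. f x * w x - y x * g x) has_integral ((y pi * w' pi - y' pi * w pi) - (y 0 * w' 0 - y' 0 * w 0))) {0..pi}"
  proof (rule FTC)
    fix x assume x: "x \<in> {0..pi}"
    show "((\<lambda>x. y x * w' x - y' x * w x) has_real_derivative f x * w x - y x * g x) (at x within {0..pi})"
      by (rule derivative_eq_intros y(6)[OF x] y(7)[OF x] w(6)[OF x] w(7)[OF x] refl)+ (simp add: algebra_simps)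
  qed
  then have "integral {0..pi} (\<lambda>x. f x * w x - y x * g x) = 0"
    using y w by (simp add: integral_unique)
  moreover have "integral {0..pi} (\<lambda>x. f x * w x - y x * g x)
     = integral {0..pi} (\<lambda>x. f x * w x) - integral {0..pi} (\<lambda>x. y x * g x)"
    by (intro integral_diff integrable_continuous_real continuous_intros y w)
  ultimately show ?thesis by simp
qed

text \<open>Integrate \<open>(y y')'\<close>: the boundary terms vanish and \<open>W >= 1\<close>.
  It follows that \<open>G\<close> is positive and has norm at most 1.\<close>

lemma neumann_sol_positive:
  assumes "neumann_sol y y' f"
  shows "integral {0..pi} (\<lambda>x. (y x)\<^sup>2) \<le> integral {0..pi} (\<lambda>x. y x * f x)"
proof -
  note y = neumann_solD[OF assms]
  have 1: "((\<lambda>x. (y' x)\<^sup>2 + W x * (y x)\<^sup>2 - y x * f x) has_integral (y pi * y' pi - y 0 * y' 0)) {0..pi}"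
  proof (rule FTC)
    fix x assume x: "x \<in> {0..pi}"
    show "((\<lambda>x. y x * y' x) has_real_derivative (y' x)\<^sup>2 + W x * (y x)\<^sup>2 - y x * f x) (at x within {0..pi})"
      by (rule derivative_eq_intros y(6)[OF x] y(7)[OF x] refl)+ (simp add: algebra_simps power2_eq_square)
  qed
  have 2: "((\<lambda>x. (y x)\<^sup>2 - y x * f x) has_integral
      (integral {0..pi} (\<lambda>x. (y x)\<^sup>2) - integral {0..pi} (\<lambda>x. y x * f x))) {0..pi}"
    by (intro has_integral_diff integrable_integral integrable_continuous_real continuous_intros y)
  have "integral {0..pi} (\<lambda>x. (y x)\<^sup>2) - integral {0..pi} (\<lambda>x. y x * f x) \<le> y pi * y' pi - y 0 * y' 0"
  proof (rule has_integral_le[OF 2 1])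
    fix x assume x: "x \<in> {0..pi}"
    have "1 * (y x)\<^sup>2 \<le> W x * (y x)\<^sup>2" using W_ge[OF in_b[OF x]] by (intro mult_right_mono) auto
    then show "(y x)\<^sup>2 - y x * f x \<le> (y' x)\<^sup>2 + W x * (y x)\<^sup>2 - y x * f x"
      by (smt (verit) zero_le_power2)
  qed
  then show ?thesis using y by simp
qed

lemma neumann_sol_diff:
  assumes "neumann_sol y y' f" "neumann_sol w w' g"
  shows "neumann_sol (\<lambda>x. y x - r * w x) (\<lambda>x. y' x - r * w' x) (\<lambda>x. f x - r * g x)"
proof -
  note y = neumann_solD[OF assms(1)] and w = neumann_solD[OF assms(2)]
  have "((\<lambda>x. y' x - r * w' x) has_real_derivative
       W x * (y x - r * w x) - (f x - r * g x)) (at x within {0..pi})" if x: "x \<in> {0..pi}" for x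
    by (rule derivative_eq_intros y(7)[OF x] w(7)[OF x] refl)+ (simp add: algebra_simps)
  moreover have "((\<lambda>x. y x - r * w x) has_real_derivative y' x - r * w' x) (at x within {0..pi})"
    if x: "x \<in> {0..pi}" for x
    by (rule derivative_eq_intros y(6)[OF x] w(6)[OF x] refl)+ simp
  ultimately show ?thesis
    unfolding neumann_sol_def using y w by (auto intro!: continuous_intros)
qed

lemma neumann_sol_u: "t \<in> S \<Longrightarrow> neumann_sol (u t) (u' t) (\<lambda>x. (t + c) * u t x)"
  unfolding neumann_sol_def using u_deriv[of _ t] cont
  by (auto simp: S_iff algebra_simps intro!: continuous_intros)

lemma k_pos: "0 < k t"
proof -
  have "k t \<noteq> 0"
    using integral_square_eq_0[OF pi_gt_zero cont(1)[of t], of 0] by (auto simp: k_def)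
  moreover have "0 \<le> k t" unfolding k_def by (auto intro!: integral_nonneg integrable_continuous_real continuous_intros cont)
  ultimately show ?thesis by simp
qed

text \<open>Positivity of \<open>G\<close> applied to an eigenfunction. This is the purpose of the
  shift by \<open>c\<close>: all \<open>t + c\<close> are at least 1 and may be divided by.\<close>

lemma S_ge: "t \<in> S \<Longrightarrow> 1 \<le> t + c"
proof -
  assume "t \<in> S"
  from neumann_sol_positive[OF neumann_sol_u[OF this]] have "k t \<le> (t + c) * k t"
    by (simp add: k_def power2_eq_square algebra_simps flip: integral_mult_right)
  then show ?thesis using k_pos[of t] by simp
qed

lemma ortho:
  assumes "s \<in> S" "t \<in> S" "s \<noteq> t"
  shows "integral {0..pi} (\<lambda>x. u s x * u t x) = 0"
proof -
  have "integral {0..pi} (\<lambda>x. (t + c) * (u s x * u t x)) = integral {0..pi} (\<lambda>x. (s + c) * (u s x * u t x))"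
    using neumann_sol_symmetric[OF neumann_sol_u neumann_sol_u, OF assms(1,2)] by (simp add: mult_ac)
  then show ?thesis using assms(3) by simp
qed

text \<open>Drop \<open>u'^2\<close> from the upper energy bound. The estimate covers
  \<open>[0,b]\<close>, because the sampling series is also estimated beyond
  \<open>pi\<close>.\<close>

lemma u_le:
  assumes "t \<in> S" "x \<in> {0..b}"
  shows "\<bar>u t x\<bar> \<le> exp (B * b)"
proof -
  have t: "1 \<le> t + c" using S_ge assms by auto
  have "(t + c) * (u t x)\<^sup>2 \<le> (u' t x)\<^sup>2 + (t + c) * (u t x)\<^sup>2" by simp
  also have "\<dots> \<le> (t + c) * exp (B * b)" by (rule energy_bounds[OF t assms(2)])
  finally have "(u t x)\<^sup>2 \<le> exp (B * b)" using t by simp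
  also have "\<dots> \<le> (exp (B * b))\<^sup>2"
    using B_ge b_pos by (simp add: power2_eq_square)
  finally show ?thesis by (metis abs_le_square_iff abs_exp_cancel)
qed

text \<open>At an eigenvalue \<open>u' t pi = 0\<close>, so the energy at \<open>pi\<close> consists
  of \<open>(t + c) * (u t pi)^2\<close> alone.\<close>

lemma u_pi_ge: "t \<in> S \<Longrightarrow> exp (- (B * b)) \<le> (u t pi)\<^sup>2"
  using energy_bounds(2)[of t pi] S_ge[of t] b pi_gt_zero by (auto simp: S_iff)

text \<open>Integrating \<open>(u u')'\<close> expresses the integral of \<open>u'^2 + W u^2\<close>
  as \<open>(t + c) * k t\<close>. Hence the integral of the energy is at most
  \<open>2 * (t + c) * k t\<close>, and the pointwise lower energy bound applies.\<close>

lemma k_ge: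
  assumes "t \<in> S"
  shows "exp (- (B * b)) * pi / 2 \<le> k t"
proof -
  have t: "1 \<le> t + c" using S_ge assms by auto
  have int: "((\<lambda>x. (u t x)\<^sup>2) has_integral k t) {0..pi}"
    unfolding k_def by (intro integrable_integral integrable_continuous_real continuous_intros cont)
  have "((\<lambda>x. (u' t x)\<^sup>2 + (W x - (t + c)) * (u t x)\<^sup>2) has_integral (u t pi * u' t pi - u t 0 * u' t 0)) {0..pi}"
  proof (rule FTC)
    fix x assume x: "x \<in> {0..pi}"
    show "((\<lambda>x. u t x * u' t x) has_real_derivative (u' t x)\<^sup>2 + (W x - (t + c)) * (u t x)\<^sup>2) (at x within {0..pi})"
      by (rule derivative_eq_intros u_deriv[OF x] refl)+ (simp add: algebra_simps power2_eq_square)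
  qed
  from has_integral_add[OF this has_integral_mult_right[OF int, of "2 * (t + c)"]]
  have 1: "((\<lambda>x. (u' t x)\<^sup>2 + W x * (u t x)\<^sup>2 + (t + c) * (u t x)\<^sup>2) has_integral 2 * (t + c) * k t) {0..pi}"
    using assms by (simp add: S_iff algebra_simps)
  have 2: "((\<lambda>x. (t + c) * exp (- (B * b))) has_integral ((t + c) * exp (- (B * b))) * (pi - 0)) {0..pi}"
    using has_integral_const_real[of "(t + c) * exp (- (B * b))" 0 pi] by (simp add: mult.commute)
  have "((t + c) * exp (- (B * b))) * (pi - 0) \<le> 2 * (t + c) * k t"
  proof (rule has_integral_le[OF 2 1])
    fix x assume x: "x \<in> {0..pi}"
    have "0 \<le> W x * (u t x)\<^sup>2" using W_ge[OF in_b[OF x]] by auto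
    then show "(t + c) * exp (- (B * b)) \<le> (u' t x)\<^sup>2 + W x * (u t x)\<^sup>2 + (t + c) * (u t x)\<^sup>2"
      using energy_bounds(2)[OF t in_b[OF x]] by simp
  qed
  then have "(t + c) * (exp (- (B * b)) * pi) \<le> (t + c) * (2 * k t)" by (simp add: algebra_simps)
  then show ?thesis using t by simp
qed

section \<open>Summability of the reciprocals of the shifted eigenvalues\<close>

text \<open>At \<open>z = - c\<close> the equation is \<open>p'' = W p\<close>. So
  \<open>p p'\<close> increases from 0 and \<open>p^2\<close> increases from 1. Thus
  \<open>p\<close> has no zero on \<open>[0,pi]\<close>, and \<open>p' pi\<close> is
  non-zero.\<close>

lemma ground_facts:
  shows "x \<in> {0..pi} \<Longrightarrow> 1 \<le> (u (- c) x)\<^sup>2" and "0 < u (- c) pi * u' (- c) pi"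
proof -
  let ?p = "u (- c)" and ?p' = "u' (- c)"
  have d: "((\<lambda>x. ?p x * ?p' x) has_real_derivative (?p' x)\<^sup>2 + W x * (?p x)\<^sup>2) (at x within {0..pi})"
    if x: "x \<in> {0..pi}" for x
    by (rule derivative_eq_intros u_deriv[OF x] refl)+ (simp add: algebra_simps power2_eq_square)
  have Wp: "(?p x)\<^sup>2 \<le> W x * (?p x)\<^sup>2" if "x \<in> {0..pi}" for x
    using mult_right_mono[OF W_ge[OF in_b[OF that]], of "(?p x)\<^sup>2"] by simp
  have pp': "0 \<le> ?p x * ?p' x" if x: "x \<in> {0..pi}" for x
  proof -
    have "- (?p x * ?p' x) \<le> - (?p 0 * ?p' 0)"
    proof (rule nonincreasing_within[OF DERIV_minus[OF d] _ x])
      fix s assume "s \<in> {0..pi}"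
      then show "- ((?p' s)\<^sup>2 + W s * (?p s)\<^sup>2) \<le> 0" using Wp[of s] by (smt (verit) zero_le_power2)
    qed
    then show ?thesis by simp
  qed
  have sq: "1 \<le> (?p x)\<^sup>2" if x: "x \<in> {0..pi}" for x
  proof -
    have "- (?p x)\<^sup>2 \<le> - (?p 0)\<^sup>2"
    proof (rule nonincreasing_within[OF _ _ x])
      fix s assume s: "s \<in> {0..pi}"
      show "((\<lambda>x. - (?p x)\<^sup>2) has_real_derivative - (2 * (?p s * ?p' s))) (at s within {0..pi})"
        by (rule derivative_eq_intros u_deriv[OF s] refl)+ simp
      show "- (2 * (?p s * ?p' s)) \<le> 0" using pp'[OF s] by simp
    qed
    then show ?thesis by simp
  qed
  then show "x \<in> {0..pi} \<Longrightarrow> 1 \<le> (?p x)\<^sup>2" .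
  have "1 * (pi - 0) \<le> ?p pi * ?p' pi - ?p 0 * ?p' 0"
  proof (rule has_integral_le[OF _ FTC[OF d]])
    show "((\<lambda>x. 1::real) has_integral 1 * (pi - 0)) {0..pi}"
      using has_integral_const_real[of "1::real" 0 pi] by simp
    fix x assume "x \<in> {0..pi}"
    then show "1 \<le> (?p' x)\<^sup>2 + W x * (?p x)\<^sup>2" using Wp[of x] sq[of x] by (smt (verit) zero_le_power2)
  qed
  then show "0 < ?p pi * ?p' pi" using pi_gt_zero by (simp del: pi_gt_zero)
qed

text \<open>With respect to the form \<open>\<integral> f' g' + W f g\<close>, the function \<open>u (- c)\<close> represents evaluation at \<open>\<pi>\<close> up to
  the factor \<open>u' (- c) \<pi>\<close>, and the eigenfunctions are orthogonal with squared norms \<open>(t + c) k t\<close>.\<close>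

lemma bessel_form:
  assumes F: "finite F" "F \<subseteq> S"
  shows "(\<Sum>t\<in>F. (u t pi)\<^sup>2 / ((t + c) * k t)) \<le> u (- c) pi / u' (- c) pi"
proof -
  let ?p = "u (- c)" and ?p' = "u' (- c)"
  \<comment> \<open>The Fourier coefficients of \<open>?p\<close> along the \<open>u t\<close>, as
    computed in \<open>orth\<close>; \<open>f\<close> is then the remainder of the projection, and
    \<open>g\<close> is what makes \<open>f'' = W f + g\<close>.\<close>
  define a where "a = (\<lambda>t. ?p' pi * u t pi / ((t + c) * k t))"
  define f where "f = (\<lambda>x. ?p x - (\<Sum>t\<in>F. a t * u t x))"
  define f' where "f' = (\<lambda>x. ?p' x - (\<Sum>t\<in>F. a t * u' t x))"
  define g where "g = (\<lambda>x. \<Sum>t\<in>F. a t * (t + c) * u t x)"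
  have pos: "0 < t + c" if "t \<in> F" for t using S_ge[of t] F that by auto
  have cf: "continuous_on {0..pi} f" and cg: "continuous_on {0..pi} g"
    unfolding f_def g_def by (intro continuous_intros cont)+
  have df: "(f has_real_derivative f' x) (at x within {0..pi})" if x: "x \<in> {0..pi}" for x
    unfolding f_def f'_def by (rule derivative_eq_intros u_deriv[OF x] refl)+ (simp add: mult.commute)
  have df': "(f' has_real_derivative W x * f x + g x) (at x within {0..pi})" if x: "x \<in> {0..pi}" for x
    unfolding f_def f'_def g_def
    by (rule derivative_eq_intros u_deriv[OF x] refl)+
      (simp add: algebra_simps sum_distrib_left sum.distrib sum_subtractf)
  have orth: "integral {0..pi} (\<lambda>x. f x * u t x) = 0" if t: "t \<in> F" for t
  proof -
    \<comment> \<open>Wronskian of the solutions at \<open>- c\<close> and \<open>t\<close>; only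
      \<open>?p' pi * u t pi\<close> survives at the ends.\<close>
    have "((\<lambda>x. (t + c) * (?p x * u t x)) has_integral
      ((?p' pi * u t pi - ?p pi * u' t pi) - (?p' 0 * u t 0 - ?p 0 * u' t 0))) {0..pi}"
    proof (rule FTC)
      fix x assume x: "x \<in> {0..pi}"
      show "((\<lambda>x. ?p' x * u t x - ?p x * u' t x) has_real_derivative (t + c) * (?p x * u t x)) (at x within {0..pi})"
        by (rule derivative_eq_intros u_deriv[OF x] refl)+ (simp add: algebra_simps)
    qed
    then have "(t + c) * integral {0..pi} (\<lambda>x. ?p x * u t x) = ?p' pi * u t pi"
      using t F by (auto dest!: integral_unique simp: S_iff subset_iff)
    then have "integral {0..pi} (\<lambda>x. ?p x * u t x) = ?p' pi * u t pi / (t + c)"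
      using pos[OF t] by (simp add: eq_divide_eq mult.commute)
    then have 1: "integral {0..pi} (\<lambda>x. ?p x * u t x) = a t * k t"
      using pos[OF t] k_pos[of t] by (simp add: a_def eq_divide_eq mult.commute)
    have "integral {0..pi} (\<lambda>x. f x * u t x)
       = integral {0..pi} (\<lambda>x. ?p x * u t x - (\<Sum>s\<in>F. a s * (u s x * u t x)))"
      by (simp add: f_def algebra_simps sum_distrib_left)
    also have "\<dots> = integral {0..pi} (\<lambda>x. ?p x * u t x) - integral {0..pi} (\<lambda>x. \<Sum>s\<in>F. a s * (u s x * u t x))"
      by (intro integral_diff integrable_continuous_real continuous_intros cont)
    also have "integral {0..pi} (\<lambda>x. \<Sum>s\<in>F. a s * (u s x * u t x)) = (\<Sum>s\<in>F. integral {0..pi} (\<lambda>x. a s * (u s x * u t x)))"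
      by (intro integral_sum F integrable_continuous_real continuous_intros cont)
    also have "\<dots> = (\<Sum>s\<in>F. if s = t then a t * k t else 0)"
      using t F by (intro sum.cong refl) (auto simp: ortho k_def power2_eq_square subset_iff)
    also have "\<dots> = a t * k t" using t F by simp
    finally show ?thesis using 1 by simp
  qed
  have 1: "((\<lambda>x. (f' x)\<^sup>2 + W x * (f x)\<^sup>2 + f x * g x) has_integral (f pi * f' pi - f 0 * f' 0)) {0..pi}"
  proof (rule FTC)
    fix x assume x: "x \<in> {0..pi}"
    show "((\<lambda>x. f x * f' x) has_real_derivative (f' x)\<^sup>2 + W x * (f x)\<^sup>2 + f x * g x) (at x within {0..pi})"
      by (rule derivative_eq_intros df[OF x] df'[OF x] refl)+ (simp add: algebra_simps power2_eq_square)
  qed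
  have 2: "f' 0 = 0" by (simp add: f'_def)
  have 3: "f' pi = ?p' pi"
    using F by (simp add: f'_def S_iff subset_iff)
  have 4: "((\<lambda>x. f x * g x) has_integral 0) {0..pi}"
  proof -
    have "integral {0..pi} (\<lambda>x. f x * g x) = integral {0..pi} (\<lambda>x. \<Sum>t\<in>F. (a t * (t + c)) * (f x * u t x))"
      by (simp add: g_def sum_distrib_left mult_ac)
    also have "\<dots> = (\<Sum>t\<in>F. integral {0..pi} (\<lambda>x. (a t * (t + c)) * (f x * u t x)))"
      by (intro integral_sum F integrable_continuous_real continuous_intros cont cf)
    also have "\<dots> = 0" by (intro sum.neutral) (simp add: orth)
    finally show ?thesis
      using integrable_integral[of "\<lambda>x. f x * g x" "{0..pi}"]
      by (auto intro!: integrable_continuous_real continuous_intros cf cg)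
  qed
  \<comment> \<open>As \<open>g\<close> is a combination of eigenfunctions, it is orthogonal to
    \<open>f\<close>, and the form evaluated at the remainder reduces to a boundary term. Its
    nonnegativity is Bessel's inequality.\<close>
  have "((\<lambda>x. (f' x)\<^sup>2 + W x * (f x)\<^sup>2) has_integral (f pi * ?p' pi)) {0..pi}"
    using has_integral_diff[OF 1 4] 2 3 by simp
  then have "0 \<le> f pi * ?p' pi"
  proof (rule has_integral_nonneg)
    fix x assume "x \<in> {0..pi}"
    then show "0 \<le> (f' x)\<^sup>2 + W x * (f x)\<^sup>2"
      using W_ge[OF in_b] by (smt (verit) mult_nonneg_nonneg zero_le_power2)
  qed
  also have "f pi * ?p' pi = ?p pi * ?p' pi - (?p' pi)\<^sup>2 * (\<Sum>t\<in>F. (u t pi)\<^sup>2 / ((t + c) * k t))"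
  proof -
    have "(\<Sum>t\<in>F. a t * u t pi) * ?p' pi = (?p' pi)\<^sup>2 * (\<Sum>t\<in>F. (u t pi)\<^sup>2 / ((t + c) * k t))"
      unfolding sum_distrib_left sum_distrib_right
      by (intro sum.cong refl) (simp add: a_def power2_eq_square)
    then show ?thesis by (simp add: f_def left_diff_distrib)
  qed
  finally have *: "(?p' pi)\<^sup>2 * (\<Sum>t\<in>F. (u t pi)\<^sup>2 / ((t + c) * k t)) \<le> ?p pi * ?p' pi" by simp
  have "?p' pi \<noteq> 0" using ground_facts(2) by auto
  then have "?p pi / ?p' pi = (?p pi * ?p' pi) / (?p' pi)\<^sup>2" by (simp add: power2_eq_square)
  with * \<open>?p' pi \<noteq> 0\<close> show ?thesis by (simp add: pos_le_divide_eq mult.commute)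
qed

text \<open>In \<open>bessel_form\<close> the factor \<open>(u t pi)^2 / k t\<close> is at least
  \<open>1 / M\<close>: \<open>k t\<close> is bounded above by \<open>u_le\<close>, and
  \<open>(u t pi)^2\<close> below by \<open>u_pi_ge\<close>. No eigenvalue asymptotics
  enter.\<close>

lemma sum_inverse_bounded:
  "\<exists>C. \<forall>F. finite F \<longrightarrow> F \<subseteq> S \<longrightarrow> (\<Sum>t\<in>F. 1 / (t + c)) \<le> C"
proof -
  define M where "M = pi * (exp (B * b))\<^sup>2 * exp (B * b)"
  have "(\<Sum>t\<in>F. 1 / (t + c)) \<le> M * (u (- c) pi / u' (- c) pi)" if F: "finite F" "F \<subseteq> S" for F
  proof -
    have "(\<Sum>t\<in>F. 1 / (t + c)) \<le> (\<Sum>t\<in>F. M * ((u t pi)\<^sup>2 / ((t + c) * k t)))"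
    proof (rule sum_mono)
      fix t assume "t \<in> F"
      then have t: "t \<in> S" "0 < t + c" using F S_ge[of t] by auto
      have "k t \<le> (exp (B * b))\<^sup>2 * pi"
      proof -
        have "((\<lambda>x. (u t x)\<^sup>2) has_integral k t) {0..pi}"
          unfolding k_def by (intro integrable_integral integrable_continuous_real continuous_intros cont)
        moreover have "((\<lambda>x. (exp (B * b))\<^sup>2) has_integral (exp (B * b))\<^sup>2 * pi) {0..pi}"
          using has_integral_const_real[of "(exp (B * b))\<^sup>2" 0 pi] by (simp add: mult.commute)
        ultimately show ?thesis
        proof (rule has_integral_le)
          fix x assume "x \<in> {0..pi}"
          then show "(u t x)\<^sup>2 \<le> (exp (B * b))\<^sup>2"
            using u_le[OF t(1) in_b] by (simp add: abs_le_square_iff[symmetric])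
        qed
      qed
      also have "\<dots> = M * exp (- (B * b))" by (simp add: M_def exp_minus field_simps)
      also have "\<dots> \<le> M * (u t pi)\<^sup>2"
        using u_pi_ge[OF t(1)] by (intro mult_left_mono) (auto simp: M_def)
      finally have "1 \<le> M * (u t pi)\<^sup>2 / k t"
        using k_pos[of t] by simp
      then have "1 / (t + c) \<le> M * (u t pi)\<^sup>2 / k t / (t + c)"
        using t(2) by (intro divide_right_mono) auto
      then show "1 / (t + c) \<le> M * ((u t pi)\<^sup>2 / ((t + c) * k t))"
        by (simp add: mult.commute)
    qed
    also have "\<dots> = M * (\<Sum>t\<in>F. (u t pi)\<^sup>2 / ((t + c) * k t))" by (simp add: sum_distrib_left)
    also have "\<dots> \<le> M * (u (- c) pi / u' (- c) pi)"
      by (intro mult_left_mono bessel_form F) (auto simp: M_def)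
    finally show ?thesis .
  qed
  then show ?thesis by blast
qed

lemma summable_inverse: "(\<lambda>t. 1 / (t + c)) summable_on S"
proof -
  obtain C where C: "\<And>F. finite F \<Longrightarrow> F \<subseteq> S \<Longrightarrow> (\<Sum>t\<in>F. 1 / (t + c)) \<le> C"
    using sum_inverse_bounded by blast
  show ?thesis
  proof (rule nonneg_bdd_above_summable_on)
    show "0 \<le> 1 / (t + c)" if "t \<in> S" for t using S_ge[OF that] by simp
    show "bdd_above (sum (\<lambda>t. 1 / (t + c)) ` {F. F \<subseteq> S \<and> finite F})"
      using C by (intro bdd_aboveI[of _ C]) auto
  qed
qed

text \<open>Each eigenvalue up to \<open>T\<close> contributes at least \<open>1 / (T + c)\<close>
  to a bounded sum. Finiteness makes the sums in \<open>sampling_partial\<close> genuine, since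
  \<open>sum\<close> over an infinite set is 0.\<close>

lemma finite_S_le: "finite {t \<in> S. t \<le> T}"
proof (rule ccontr)
  assume inf: "infinite {t \<in> S. t \<le> T}"
  obtain C where C: "\<And>F. finite F \<Longrightarrow> F \<subseteq> S \<Longrightarrow> (\<Sum>t\<in>F. 1 / (t + c)) \<le> C"
    using sum_inverse_bounded by blast
  obtain t0 where "t0 \<in> S" "t0 \<le> T" using infinite_imp_nonempty[OF inf] by auto
  then have T: "1 \<le> T + c" using S_ge[of t0] by simp
  obtain n :: nat where n: "C * (T + c) < real n" using reals_Archimedean2 by blast
  obtain F where F: "finite F" "card F = n" "F \<subseteq> {t \<in> S. t \<le> T}"
    using infinite_arbitrarily_large[OF inf] by metis
  have "real n * (1 / (T + c)) = (\<Sum>t\<in>F. 1 / (T + c))" using F by simp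
  also have "\<dots> \<le> (\<Sum>t\<in>F. 1 / (t + c))"
  proof (rule sum_mono)
    fix t assume "t \<in> F"
    then have "t \<in> S" "t \<le> T" using F by auto
    then show "1 / (T + c) \<le> 1 / (t + c)" using S_ge[of t] by (intro divide_left_mono) auto
  qed
  also have "\<dots> \<le> C" using F by (intro C) auto
  finally show False using n T by (simp add: field_simps)
qed

section \<open>The Green operator and the resolvent\<close>

lemma green_exists:
  assumes f: "continuous_on {0..pi} f"
  shows "\<exists>y y'. neumann_sol y y' f"
proof -
  let ?p = "u (- c)" and ?p' = "u' (- c)"
  have p0: "?p x \<noteq> 0" if "x \<in> {0..pi}" for x using ground_facts(1)[OF that] by auto
  have p'0: "?p pi \<noteq> 0" "?p' pi \<noteq> 0" using ground_facts(2) by auto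
  \<comment> \<open>Reduction of order: \<open>y = p v\<close> turns the equation into \<open>(p\<^sup>2 v')' = - p f\<close>.\<close>
  define h where "h = (\<lambda>x. integral {0..x} (\<lambda>s. ?p s * f s))"
  have dh: "(h has_real_derivative ?p x * f x) (at x within {0..pi})" if "x \<in> {0..pi}" for x
    unfolding h_def has_real_derivative_iff_has_vector_derivative
    using that by (intro integral_has_vector_derivative continuous_intros cont f)
  have ch: "continuous_on {0..pi} h" by (rule DERIV_continuous_on[OF dh])
  define v where "v = (\<lambda>x. integral {0..x} (\<lambda>s. - (h s / (?p s)\<^sup>2)))"
  have dv: "(v has_real_derivative - (h x / (?p x)\<^sup>2)) (at x within {0..pi})" if "x \<in> {0..pi}" for x
    unfolding v_def has_real_derivative_iff_has_vector_derivative
    using that p0 by (intro integral_has_vector_derivative continuous_intros cont ch) auto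
  \<comment> \<open>Chosen so that \<open>y' pi = 0\<close>; the condition at 0 holds for every
    \<alpha>, since \<open>?p' 0 = 0\<close> and \<open>h 0 = 0\<close>.\<close>
  define \<alpha> where "\<alpha> = h pi / (?p pi * ?p' pi) - v pi"
  define y where "y = (\<lambda>x. ?p x * (\<alpha> + v x))"
  define y' where "y' = (\<lambda>x. ?p' x * (\<alpha> + v x) - h x / ?p x)"
  have "(y has_real_derivative y' x) (at x within {0..pi})" if x: "x \<in> {0..pi}" for x
    unfolding y_def y'_def
    by (rule derivative_eq_intros u_deriv[OF x] dv[OF x] refl)+
      (use p0[OF x] in \<open>simp add: field_simps power2_eq_square\<close>)
  moreover have "(y' has_real_derivative W x * y x - f x) (at x within {0..pi})" if x: "x \<in> {0..pi}" for x
    unfolding y_def y'_def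
    by (rule derivative_eq_intros u_deriv[OF x] dv[OF x] dh[OF x] p0[OF x] refl)+
      (use p0[OF x] in \<open>simp add: field_simps power2_eq_square\<close>)
  moreover have "y' 0 = 0" by (simp add: y'_def h_def)
  moreover have "y' pi = 0" using p'0 by (simp add: y'_def \<alpha>_def)
  ultimately have "neumann_sol y y' f" using f by (auto simp: neumann_sol_def)
  then show ?thesis by blast
qed

text \<open>The function \<open>q = y - y 0 * u t\<close>, with \<open>t = \<rho> - c\<close>, has
  zero initial data, so \<open>gronwall_energy\<close> bounds it by \<open>h\<close>. It remains to
  bound \<open>y 0\<close>. If \<open>t\<close> is not an eigenvalue, the condition
  \<open>y' pi = 0\<close> determines it from \<open>q' pi\<close>; otherwise orthogonality of
  \<open>y\<close> to \<open>u t\<close> determines it from \<open>q\<close>.\<close>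

lemma resolvent_bound:
  "\<exists>C\<ge>0. \<forall>y y' h. continuous_on {0..pi} h \<longrightarrow> neumann_sol y y' (\<lambda>x. h x + \<rho> * y x) \<longrightarrow>
     (\<forall>t\<in>S. integral {0..pi} (\<lambda>x. y x * u t x) = 0) \<longrightarrow>
     integral {0..pi} (\<lambda>x. (y x)\<^sup>2) \<le> C * integral {0..pi} (\<lambda>x. (h x)\<^sup>2)"
proof -
  define t where "t = \<rho> - c"
  define G where "G = exp ((B + \<bar>\<rho>\<bar> + 2) * pi)"
  \<comment> \<open>\<open>D\<close> bounds \<open>(y 0)^2\<close> relative to the squared norm of
    \<open>h\<close>, separately in the two cases.\<close>
  define D where "D = (if t \<in> S then pi * G / k t else G / (u' t pi)\<^sup>2)"
  have D: "D \<ge> 0" using k_pos[of t] pi_gt_zero by (auto simp: D_def G_def simp del: pi_gt_zero)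
  have main: "integral {0..pi} (\<lambda>x. (y x)\<^sup>2) \<le> (2 * pi * G + 2 * D * k t) * integral {0..pi} (\<lambda>x. (h x)\<^sup>2)"
    if ch: "continuous_on {0..pi} h" and n: "neumann_sol y y' (\<lambda>x. h x + \<rho> * y x)"
      and orth: "\<forall>t\<in>S. integral {0..pi} (\<lambda>x. y x * u t x) = 0" for y y' h
  proof -
    note y = neumann_solD[OF n]
    define N where "N = integral {0..pi} (\<lambda>x. (h x)\<^sup>2)"
    define q where "q = (\<lambda>x. y x - y 0 * u t x)"
    define q' where "q' = (\<lambda>x. y' x - y 0 * u' t x)"
    have cq: "continuous_on {0..pi} q" unfolding q_def by (intro continuous_intros cont y)
    have N0: "0 \<le> N" unfolding N_def
      by (intro integral_nonneg integrable_continuous_real continuous_intros ch) auto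
    have qb: "(q x)\<^sup>2 + (q' x)\<^sup>2 \<le> G * N" if x: "x \<in> {0..pi}" for x
    proof -
      have "(norm (q x))\<^sup>2 + (norm (q' x))\<^sup>2 \<le> exp ((B + \<bar>\<rho>\<bar> + 2) * x)
         * ((norm (q 0))\<^sup>2 + (norm (q' 0))\<^sup>2 + integral {0..x} (\<lambda>s. \<bar>h s\<bar>\<^sup>2))"
      proof (rule gronwall_energy[OF _ _ _ _ _ x])
        fix s assume s: "s \<in> {0..pi}"
        show "(q has_vector_derivative q' s) (at s within {0..pi})"
          unfolding q_def q'_def has_real_derivative_iff_has_vector_derivative[symmetric]
          by (rule derivative_eq_intros u_deriv[OF s] y(6)[OF s] refl)+ simp
        show "(q' has_vector_derivative ((W s - \<rho>) * q s - h s)) (at s within {0..pi})"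
          unfolding q_def q'_def has_real_derivative_iff_has_vector_derivative[symmetric]
          by (rule derivative_eq_intros u_deriv[OF s] y(7)[OF s] refl)+ (simp add: t_def algebra_simps)
        have "\<bar>W s - \<rho>\<bar> \<le> B + \<bar>\<rho>\<bar>" using W_ge[OF in_b[OF s]] W_le[OF in_b[OF s]] by simp
        then have "\<bar>(W s - \<rho>) * q s\<bar> \<le> (B + \<bar>\<rho>\<bar>) * \<bar>q s\<bar>" by (simp add: abs_mult mult_right_mono)
        then show "norm ((W s - \<rho>) * q s - h s) \<le> (B + \<bar>\<rho>\<bar>) * norm (q s) + \<bar>h s\<bar>" by simp
      qed (use B_ge in \<open>auto intro!: continuous_intros ch\<close>)
      also have "\<dots> = exp ((B + \<bar>\<rho>\<bar> + 2) * x) * integral {0..x} (\<lambda>s. (h s)\<^sup>2)"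
        by (simp add: q_def q'_def y)
      also have "\<dots> \<le> G * N"
        unfolding G_def N_def
      proof (intro mult_mono)
        have int: "(\<lambda>s. (h s)\<^sup>2) integrable_on {0..pi}"
          by (intro integrable_continuous_real continuous_intros ch)
        then have int': "(\<lambda>s. (h s)\<^sup>2) integrable_on {0..x}"
          by (rule integrable_on_subinterval) (use x in auto)
        show "integral {0..x} (\<lambda>s. (h s)\<^sup>2) \<le> integral {0..pi} (\<lambda>s. (h s)\<^sup>2)"
          by (intro integral_subset_le int int') (use x in auto)
        show "0 \<le> integral {0..x} (\<lambda>s. (h s)\<^sup>2)"
          by (intro integral_nonneg int') auto
      qed (use x B_ge in \<open>auto intro: mult_left_mono\<close>)
      finally show ?thesis by simp
    qed
    have q2: "(q x)\<^sup>2 \<le> G * N" if x: "x \<in> {0..pi}" for x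
      using qb[OF x] by (smt (verit) zero_le_power2)
    have const: "((\<lambda>x. K) has_integral K * pi) {0..pi}" for K :: real
      using has_integral_const_real[of K 0 pi] by (simp add: mult.commute)
    have intq: "((\<lambda>x. (q x)\<^sup>2) has_integral integral {0..pi} (\<lambda>x. (q x)\<^sup>2)) {0..pi}"
      by (intro integrable_integral integrable_continuous_real continuous_intros cq)
    have iq: "integral {0..pi} (\<lambda>x. (q x)\<^sup>2) \<le> G * N * pi"
      by (rule has_integral_le[OF intq const]) (rule q2)
    have y0: "(y 0)\<^sup>2 \<le> D * N"
    proof (cases "t \<in> S")
      case False
      then have nz: "u' t pi \<noteq> 0" by (simp add: S_iff)
      have "(y 0 * u' t pi)\<^sup>2 = (q' pi)\<^sup>2" using y by (simp add: q'_def)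
      also have "\<dots> \<le> G * N" using qb[of pi] pi_ge_zero by (smt (verit) zero_le_power2 atLeastAtMost_iff)
      finally show ?thesis using nz False by (simp add: D_def power_mult_distrib field_simps)
    next
      case True
      have "integral {0..pi} (\<lambda>x. q x * u t x) = integral {0..pi} (\<lambda>x. y x * u t x - y 0 * (u t x)\<^sup>2)"
        by (simp add: q_def algebra_simps power2_eq_square)
      also have "\<dots> = integral {0..pi} (\<lambda>x. y x * u t x) - integral {0..pi} (\<lambda>x. y 0 * (u t x)\<^sup>2)"
        by (intro integral_diff integrable_continuous_real continuous_intros cont y)
      also have "\<dots> = - (y 0 * k t)" using orth True by (simp add: k_def)
      finally have "(y 0 * k t)\<^sup>2 \<le> integral {0..pi} (\<lambda>x. (q x)\<^sup>2) * k t"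
        using integral_Cauchy_Schwarz[OF cq cont(1)[of t]] by (simp add: k_def)
      also have "\<dots> \<le> G * N * pi * k t" using iq k_pos[of t] by (intro mult_right_mono) auto
      finally show ?thesis using True k_pos[of t] by (simp add: D_def power2_eq_square field_simps)
    qed
    have "integral {0..pi} (\<lambda>x. (y x)\<^sup>2) \<le> 2 * (G * N) * pi + 2 * (D * N) * k t"
    proof (rule has_integral_le)
      show "((\<lambda>x. (y x)\<^sup>2) has_integral integral {0..pi} (\<lambda>x. (y x)\<^sup>2)) {0..pi}"
        by (intro integrable_integral integrable_continuous_real continuous_intros y)
      show "((\<lambda>x. 2 * (G * N) + 2 * (D * N) * (u t x)\<^sup>2) has_integral 2 * (G * N) * pi + 2 * (D * N) * k t) {0..pi}"
        unfolding k_def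
        by (rule has_integral_add[OF const]) (intro has_integral_mult_right integrable_integral
            integrable_continuous_real continuous_intros cont)
      fix x assume x: "x \<in> {0..pi}"
      have "(y x)\<^sup>2 = (q x + y 0 * u t x)\<^sup>2" by (simp add: q_def)
      also have "\<dots> \<le> 2 * (q x)\<^sup>2 + 2 * (y 0 * u t x)\<^sup>2"
        using sum_squares_bound[of "q x" "y 0 * u t x"] by (simp add: power2_sum)
      also have "\<dots> \<le> 2 * (G * N) + 2 * (D * N * (u t x)\<^sup>2)"
        using q2[OF x] mult_right_mono[OF y0, of "(u t x)\<^sup>2"] by (simp add: power_mult_distrib)
      finally show "(y x)\<^sup>2 \<le> 2 * (G * N) + 2 * (D * N) * (u t x)\<^sup>2" by (simp add: mult.assoc)
    qed
    also have "\<dots> = (2 * pi * G + 2 * D * k t) * N" by (simp add: algebra_simps)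
    finally show ?thesis by (simp add: N_def)
  qed
  show ?thesis
  proof (intro exI conjI allI impI)
    show "0 \<le> 2 * pi * G + 2 * D * k t" using D k_pos[of t] by (auto simp: G_def)
  qed (rule main)
qed

subsection \<open>Completeness of the eigenfunctions\<close>

text \<open>Injectivity of \<open>G\<close>: if \<open>y\<close> vanishes then so do
  \<open>y'\<close> and \<open>y''\<close>. Hence the iterates of \<open>G\<close> on a non-zero
  function never vanish.\<close>

lemma neumann_sol_imp_zero:
  assumes n: "neumann_sol y y' f" and y0: "\<And>x. x \<in> {0..pi} \<Longrightarrow> y x = 0" and x: "x \<in> {0..pi}"
  shows "f x = 0"
proof -
  note y = neumann_solD[OF n]
  have z: "((\<lambda>x. 0::real) has_real_derivative 0) (at x within {0..pi})" for x by simp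
  have u: "d = 0" if x: "x \<in> {0..pi}" and d: "(g has_real_derivative d) (at x within {0..pi})"
    and g0: "\<And>x. x \<in> {0..pi} \<Longrightarrow> g x = 0" for g x d
  proof -
    have "(g has_vector_derivative 0) (at x within {0..pi})"
      by (rule has_vector_derivative_transform[OF x _ has_vector_derivative_const]) (simp add: g0)
    then show ?thesis
      using d x pi_gt_zero vector_derivative_unique_within_closed_interval[of 0 pi x g d 0]
      by (simp add: has_real_derivative_iff_has_vector_derivative)
  qed
  have y'0: "y' x = 0" if "x \<in> {0..pi}" for x
    using u[OF that y(6)[OF that] y0] .
  have "W x * y x - f x = 0"
    using u[OF x y(7)[OF x] y'0] .
  then show ?thesis using y0[OF x] by simp
qed

theorem completeness:
  assumes c\<delta>: "continuous_on {0..pi} \<delta>"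
    and orth\<delta>: "\<And>t. t \<in> S \<Longrightarrow> integral {0..pi} (\<lambda>x. \<delta> x * u t x) = 0"
    and x: "x \<in> {0..pi}"
  shows "\<delta> x = 0"
proof (rule ccontr)
  assume nz: "\<delta> x \<noteq> 0"
  define G where "G = (\<lambda>f. SOME y. \<exists>y'. neumann_sol y y' f)"
  define f where "f = (\<lambda>n. (G ^^ n) \<delta>)"
  have G: "\<exists>y'. neumann_sol (G g) y' g" if "continuous_on {0..pi} g" for g
    unfolding G_def by (rule someI_ex[OF green_exists[OF that]])
  have cf: "continuous_on {0..pi} (f n)" for n
    by (induction n) (use c\<delta> G neumann_solD(2) in \<open>auto simp: f_def\<close>)
  have "\<exists>f'. neumann_sol (f (Suc n)) f' (f n)" for n
    using G[OF cf[of n]] by (simp add: f_def)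
  then obtain f' where n: "\<And>n. neumann_sol (f (Suc n)) (f' n) (f n)" by metis
  \<comment> \<open>\<open>G\<close> is symmetric and maps each \<open>u t\<close> to a multiple of
    itself, so it preserves the orthogonal complement.\<close>
  have orth: "integral {0..pi} (\<lambda>x. f n x * u t x) = 0" if t: "t \<in> S" for n t
  proof (induction n)
    case 0
    then show ?case using orth\<delta>[OF t] by (simp add: f_def)
  next
    case (Suc n)
    have "integral {0..pi} (\<lambda>x. f (Suc n) x * ((t + c) * u t x)) = 0"
      using neumann_sol_symmetric[OF n neumann_sol_u[OF t], of n] Suc by simp
    then have "(t + c) * integral {0..pi} (\<lambda>x. f (Suc n) x * u t x) = 0"
      by (simp add: mult.left_commute)
    then show ?case using S_ge[OF t] by auto
  qed
  define N where "N = (\<lambda>n. integral {0..pi} (\<lambda>x. (f n x)\<^sup>2))"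
  have N_ge: "0 \<le> N n" for n
    unfolding N_def by (intro integral_nonneg integrable_continuous_real continuous_intros cf) auto
  have N_pos: "0 < N n" for n
  proof (induction n)
    case 0
    have "N 0 \<noteq> 0" using integral_square_eq_0[OF pi_gt_zero c\<delta> _ x] nz by (auto simp: N_def f_def)
    then show ?case using N_ge[of 0] by simp
  next
    case (Suc m)
    have "N (Suc m) \<noteq> 0"
    proof
      assume "N (Suc m) = 0"
      then have "f m x = 0" if "x \<in> {0..pi}" for x
        using neumann_sol_imp_zero[OF n _ that] integral_square_eq_0[OF pi_gt_zero cf[of "Suc m"]] by (auto simp: N_def)
      then have "N m = integral {0..pi} (\<lambda>x. 0::real)"
        unfolding N_def by (intro integral_cong) auto
      then show False using Suc by simp
    qed
    then show ?case using N_ge[of "Suc m"] by simp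
  qed
  \<comment> \<open>Symmetry turns \<open>N (Suc m)\<close> into the inner product of
    \<open>f m\<close> and \<open>f (Suc (Suc m))\<close>. This log-convexity makes the ratios
    \<open>r\<close> increase.\<close>
  have N_convex: "(N (Suc m))\<^sup>2 \<le> N m * N (Suc (Suc m))" for m
    using neumann_sol_symmetric[OF n n, of m "Suc m"] integral_Cauchy_Schwarz[OF cf cf, of m "Suc (Suc m)"]
    by (simp add: N_def power2_eq_square)
  have N_decr: "N (Suc m) \<le> N m" for m
  proof -
    have "N (Suc m) \<le> integral {0..pi} (\<lambda>x. f (Suc m) x * f m x)"
      using neumann_sol_positive[OF n[of m]] by (simp add: N_def)
    then have "(N (Suc m))\<^sup>2 \<le> (integral {0..pi} (\<lambda>x. f (Suc m) x * f m x))\<^sup>2"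
      using N_ge by (intro power_mono) auto
    also have "\<dots> \<le> N (Suc m) * N m"
      using integral_Cauchy_Schwarz[OF cf cf, of "Suc m" m] by (simp add: N_def)
    finally show ?thesis using N_pos[of "Suc m"] by (simp add: power2_eq_square)
  qed
  define r where "r = (\<lambda>m. N (Suc m) / N m)"
  have "incseq r"
  proof (rule incseq_SucI)
    fix m show "r m \<le> r (Suc m)"
      using N_convex[of m] N_pos[of m] N_pos[of "Suc m"]
      by (simp add: r_def pos_divide_le_eq pos_le_divide_eq power2_eq_square mult.commute)
  qed
  moreover have "\<forall>m. r m \<le> 1" using N_decr N_pos by (simp add: r_def)
  ultimately obtain \<Lambda> where lim: "r \<longlonglongrightarrow> \<Lambda>" and r_le: "\<forall>m. r m \<le> \<Lambda>"
    by (rule incseq_convergent)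
  have "0 < r 0" using N_pos by (simp add: r_def)
  then have \<Lambda>: "0 < \<Lambda>" using r_le[rule_format, of 0] by linarith
  \<comment> \<open>The \<open>N m\<close> are squared norms, so the ratios of the norms themselves
    tend to the square root. An eigenvalue \<open>l\<close> of \<open>G\<close> would correspond to
    the point \<open>\<rho> = 1 / l\<close> for the differential operator.\<close>
  define l where "l = sqrt \<Lambda>"
  have l: "0 < l" "l\<^sup>2 = \<Lambda>" using \<Lambda> by (simp_all add: l_def)
  define \<rho> where "\<rho> = 1 / l"
  have \<rho>l: "\<rho> * l = 1" using l by (simp add: \<rho>_def)
  obtain C where C: "C \<ge> 0" "\<And>y y' h. continuous_on {0..pi} h \<Longrightarrow> neumann_sol y y' (\<lambda>x. h x + \<rho> * y x) \<Longrightarrow>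
     (\<And>t. t \<in> S \<Longrightarrow> integral {0..pi} (\<lambda>x. y x * u t x) = 0) \<Longrightarrow>
     integral {0..pi} (\<lambda>x. (y x)\<^sup>2) \<le> C * integral {0..pi} (\<lambda>x. (h x)\<^sup>2)"
    using resolvent_bound[of \<rho>] by blast
  \<comment> \<open>\<open>K\<close> bounds \<open>f m\<close> by \<open>(G - l) (f m)\<close> in
    squared norm. \<open>d m\<close> is the squared norm of
    \<open>f (Suc (Suc m)) - \<Lambda> * f m\<close> divided by \<open>N m\<close>, which tends to
    0.\<close>
  define K where "K = (2 + 2 * \<rho>\<^sup>2 * C) * \<rho>\<^sup>2"
  define d where "d = (\<lambda>m. r (Suc m) * r m - 2 * \<Lambda> * r m + \<Lambda>\<^sup>2)"
  have "\<Lambda> \<le> K * d m" for m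
  proof -
    \<comment> \<open>\<open>(G\<^sup>2 - \<Lambda>) = (G + l) (G - l)\<close>, where \<open>G + l\<close> is bounded below since \<open>G \<ge> 0\<close>, and \<open>G - l\<close> by
      the resolvent bound at \<open>\<rho> = 1 / l\<close>.\<close>
    define e where "e = (\<lambda>x. f (Suc m) x - l * f m x)"
    define h where "h = (\<lambda>x. f m x - \<rho> * f (Suc m) x)"
    define w where "w = (\<lambda>x. f (Suc (Suc m)) x - l * f (Suc m) x)"
    define E where "E = integral {0..pi} (\<lambda>x. (e x)\<^sup>2)"
    have ce: "continuous_on {0..pi} e" and ch: "continuous_on {0..pi} h" and cw: "continuous_on {0..pi} w"
      unfolding e_def h_def w_def by (intro continuous_intros cf)+
    have he: "h x = - (\<rho> * e x)" for x
      using \<rho>l by (simp add: h_def e_def algebra_simps)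
    have H: "integral {0..pi} (\<lambda>x. (h x)\<^sup>2) = \<rho>\<^sup>2 * E"
      by (simp add: he E_def power_mult_distrib)
    \<comment> \<open>By definition of \<open>h\<close>,
      \<open>f m = h + \<rho> * f (Suc m)\<close>, so \<open>f (Suc m)\<close> solves the resolvent
      equation at \<rho> with right-hand side \<open>h = - \<rho> * e\<close>.\<close>
    have NH: "N (Suc m) \<le> C * (\<rho>\<^sup>2 * E)"
      unfolding H[symmetric] N_def
      by (rule C(2)[OF ch _ orth, where y' = "f' m"]) (use n[of m] in \<open>simp_all add: h_def\<close>)
    have "N m \<le> 2 * (\<rho>\<^sup>2 * E) + 2 * \<rho>\<^sup>2 * N (Suc m)"
    proof (rule has_integral_le)
      show "((\<lambda>x. (f m x)\<^sup>2) has_integral N m) {0..pi}"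
        unfolding N_def by (intro integrable_integral integrable_continuous_real continuous_intros cf)
      show "((\<lambda>x. 2 * (h x)\<^sup>2 + 2 * \<rho>\<^sup>2 * (f (Suc m) x)\<^sup>2) has_integral 2 * (\<rho>\<^sup>2 * E) + 2 * \<rho>\<^sup>2 * N (Suc m)) {0..pi}"
        unfolding N_def H[symmetric]
        by (intro has_integral_add has_integral_mult_right integrable_integral integrable_continuous_real continuous_intros cf ch)
      fix x
      have "(f m x)\<^sup>2 = (h x + \<rho> * f (Suc m) x)\<^sup>2" by (simp add: h_def)
      also have "\<dots> \<le> 2 * (h x)\<^sup>2 + 2 * (\<rho> * f (Suc m) x)\<^sup>2"
        using sum_squares_bound[of "h x" "\<rho> * f (Suc m) x"] by (simp add: power2_sum)
      finally show "(f m x)\<^sup>2 \<le> 2 * (h x)\<^sup>2 + 2 * \<rho>\<^sup>2 * (f (Suc m) x)\<^sup>2"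
        by (simp add: power_mult_distrib)
    qed
    also have "\<dots> \<le> 2 * (\<rho>\<^sup>2 * E) + 2 * \<rho>\<^sup>2 * (C * (\<rho>\<^sup>2 * E))"
      using NH by (intro add_left_mono mult_left_mono) auto
    also have "\<dots> = K * E" by (simp add: K_def algebra_simps)
    finally have NE: "N m \<le> K * E" .
    \<comment> \<open>Thus \<open>w = G e\<close>, and \<open>w + l * e\<close> is
      \<open>(G + l) (G - l) (f m) = f (Suc (Suc m)) - \<Lambda> * f m\<close>. Positivity of
      \<open>G\<close> makes the cross term nonnegative.\<close>
    have nw: "neumann_sol w (\<lambda>x. f' (Suc m) x - l * f' m x) e"
      unfolding w_def e_def by (rule neumann_sol_diff[OF n n])
    have "0 \<le> integral {0..pi} (\<lambda>x. (w x)\<^sup>2)"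
      by (intro integral_nonneg integrable_continuous_real continuous_intros cw) auto
    with neumann_sol_positive[OF nw] have we: "0 \<le> integral {0..pi} (\<lambda>x. w x * e x)"
      "0 \<le> integral {0..pi} (\<lambda>x. (w x)\<^sup>2)" by auto
    have "integral {0..pi} (\<lambda>x. (w x + l * e x)\<^sup>2)
      = integral {0..pi} (\<lambda>x. (w x)\<^sup>2) + 2 * l * integral {0..pi} (\<lambda>x. w x * e x) + \<Lambda> * E"
      by (simp add: integral_square_add[OF cw ce] E_def l)
    then have "\<Lambda> * E \<le> integral {0..pi} (\<lambda>x. (w x + l * e x)\<^sup>2)"
      using we l by simp
    also have "\<dots> = integral {0..pi} (\<lambda>x. (f (Suc (Suc m)) x + (- \<Lambda>) * f m x)\<^sup>2)"
      by (simp add: w_def e_def l(2)[symmetric] power2_eq_square algebra_simps)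
    also have "\<dots> = N (Suc (Suc m)) - 2 * \<Lambda> * N (Suc m) + \<Lambda>\<^sup>2 * N m"
      using neumann_sol_symmetric[OF n n, of "Suc m" m]
      unfolding integral_square_add[OF cf cf] by (simp add: N_def power2_eq_square)
    also have "\<dots> = N m * d m"
      using N_pos[of m] N_pos[of "Suc m"] by (simp add: d_def r_def field_simps)
    finally have "\<Lambda> * E \<le> N m * d m" .
    then have "K * (\<Lambda> * E) \<le> K * (N m * d m)"
      using C(1) by (intro mult_left_mono) (auto simp: K_def)
    moreover have "\<Lambda> * N m \<le> \<Lambda> * (K * E)" using NE \<Lambda> by simp
    ultimately have "\<Lambda> * N m \<le> (K * d m) * N m" by (simp add: algebra_simps)
    then show ?thesis using N_pos[of m] by simp
  qed
  \<comment> \<open>This limit is 0, contradicting the positive lower bound \<Lambda>.\<close>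
  moreover have "(\<lambda>m. K * d m) \<longlonglongrightarrow> K * (\<Lambda> * \<Lambda> - 2 * \<Lambda> * \<Lambda> + \<Lambda>\<^sup>2)"
    unfolding d_def by (intro tendsto_intros lim LIMSEQ_Suc)
  ultimately have "\<Lambda> \<le> K * (\<Lambda> * \<Lambda> - 2 * \<Lambda> * \<Lambda> + \<Lambda>\<^sup>2)"
    by (intro LIMSEQ_le_const) auto
  then show False using \<Lambda> by (simp add: power2_eq_square)
qed

subsection \<open>The sampling series\<close>

text \<open>The factor of \<open>g(t)\<close> in the sampling series, and at the same time, for
  \<open>t\<close> in \<open>S\<close>, the Fourier coefficient of \<open>\<xi> z\<close> on
  \<open>[0,pi]\<close> along the eigenfunction at \<open>t\<close>.\<close>

definition "coef t z = kernel_conj \<xi> pi (of_real t) z / kernel_conj \<xi> pi (of_real t) (of_real t)"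

lemma xi_cont_pi: "continuous_on {0..pi} (\<xi> z)"
  using xi_cont(1) by (rule continuous_on_subset) (use b in auto)

lemma kernel_diag: "kernel_conj \<xi> pi (of_real t) (of_real t) = of_real (k t)"
  unfolding kernel_conj_def
proof (rule integral_unique)
  have "((\<lambda>x. complex_of_real ((u t x)\<^sup>2)) has_integral of_real (k t)) {0..pi}"
    unfolding k_def
    by (intro has_integral_of_real integrable_integral integrable_continuous_real continuous_intros cont)
  then show "((\<lambda>x. \<xi> (of_real t) x * \<xi> (of_real t) x) has_integral of_real (k t)) {0..pi}"
    by (rule has_integral_eq[rotated]) (simp add: xi_real(1)[OF in_b] power2_eq_square)
qed

text \<open>Lagrange identity, left undivided so that it also covers \<open>z = w\<close>. At an
  eigenvalue \<open>w\<close> only the second boundary term remains.\<close>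

lemma kernel_green:
  "(z - w) * kernel_conj \<xi> pi w z = \<xi>' w pi * \<xi> z pi - \<xi> w pi * \<xi>' z pi"
proof -
  have "((\<lambda>x. (z - w) * (\<xi> w x * \<xi> z x)) has_integral
     ((\<xi>' w pi * \<xi> z pi - \<xi> w pi * \<xi>' z pi) - (\<xi>' w 0 * \<xi> z 0 - \<xi> w 0 * \<xi>' z 0))) {0..pi}"
  proof (rule fundamental_theorem_of_calculus)
    fix x assume x: "x \<in> {0..pi}"
    have sub: "{0..pi} \<subseteq> {0..b}" using b by auto
    note d = has_vector_derivative_within_subset[OF xi_deriv[OF in_b[OF x]] sub]
      and d' = has_vector_derivative_within_subset[OF xi'_deriv[OF in_b[OF x]] sub]
    show "((\<lambda>x. \<xi>' w x * \<xi> z x - \<xi> w x * \<xi>' z x) has_vector_derivative (z - w) * (\<xi> w x * \<xi> z x)) (at x within {0..pi})"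
      by (rule has_vector_derivative_eq_rhs[OF has_vector_derivative_diff[OF
            has_vector_derivative_mult[OF d' d] has_vector_derivative_mult[OF d d']]])
        (simp add: algebra_simps)
  qed simp
  then show ?thesis by (auto simp: kernel_conj_def xi0 xi'0 dest!: integral_unique)
qed

lemma xi_S_le: "t \<in> S \<Longrightarrow> x \<in> {0..b} \<Longrightarrow> cmod (\<xi> (of_real t) x) \<le> exp (B * b)"
  by (simp add: xi_real u_le)

text \<open>For \<open>t + c >= 2 R\<close> the distance from \<open>z\<close> to \<open>t\<close>
  is at least \<open>(t + c) / 2\<close>, and \<open>kernel_green\<close> yields the decay. For
  smaller \<open>t\<close> the direct bound \<open>M * pi\<close> suffices, as
  \<open>2 R / (t + c)\<close> exceeds 1. The denominator is handled by \<open>k_ge\<close>.\<close>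

lemma coef_bound:
  assumes R: "0 \<le> R"
  obtains C where "0 \<le> C"
    "\<And>t z. t \<in> S \<Longrightarrow> cmod (z + of_real c) \<le> R \<Longrightarrow> cmod (coef t z) \<le> C / (t + c)"
proof
  define M where "M = exp (B * b) * exp ((B + R + 2) * b)"
  define \<kappa> where "\<kappa> = exp (- (B * b)) * pi / 2"
  have M: "0 < M" and \<kappa>: "0 < \<kappa>" by (simp_all add: M_def \<kappa>_def)
  show "0 \<le> (2 + 2 * pi * R) * M / \<kappa>" using M \<kappa> R by simp
  fix t z assume t: "t \<in> S" and z: "cmod (z + of_real c) \<le> R"
  have \<mu>: "1 \<le> t + c" by (rule S_ge[OF t])
  have pi_in: "pi \<in> {0..b}" using b by auto
  have "cmod (kernel_conj \<xi> pi (of_real t) z) \<le> (2 + 2 * pi * R) * M / (t + c)"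
  proof (cases "2 * R \<le> t + c")
    case True
    have "t + c \<le> cmod (z - of_real t) + R"
      using norm_triangle_ineq4[of "z + of_real c" "z - of_real t"] z \<mu>
      by (simp flip: of_real_add)
    then have far: "(t + c) / 2 \<le> cmod (z - of_real t)" using True by simp
    have "cmod (z - of_real t) * cmod (kernel_conj \<xi> pi (of_real t) z)
       = cmod (\<xi> (of_real t) pi) * cmod (\<xi>' z pi)"
      using arg_cong[OF kernel_green[of z "of_real t"], of cmod] t
      by (simp add: norm_mult S_def spec_neumann_def)
    also have "\<dots> \<le> M"
      unfolding M_def using xi_S_le[OF t pi_in] xi_bound(2)[OF pi_in z] by (intro mult_mono) auto
    finally have "(t + c) / 2 * cmod (kernel_conj \<xi> pi (of_real t) z) \<le> M"
      using mult_right_mono[OF far, of "cmod (kernel_conj \<xi> pi (of_real t) z)"] by simp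
    then have "cmod (kernel_conj \<xi> pi (of_real t) z) \<le> 2 * M / (t + c)"
      using \<mu> by (simp add: field_simps)
    also have "\<dots> \<le> (2 + 2 * pi * R) * M / (t + c)"
      using \<mu> M R by (intro divide_right_mono mult_right_mono) auto
    finally show ?thesis .
  next
    case False
    have "cmod (kernel_conj \<xi> pi (of_real t) z) \<le> M * (pi - 0)"
      unfolding kernel_conj_def
    proof (rule integral_bound)
      show "continuous_on {0..pi} (\<lambda>x. \<xi> (of_real t) x * \<xi> z x)"
        by (intro continuous_intros xi_cont_pi)
      fix x assume "x \<in> {0..pi}"
      then show "cmod (\<xi> (of_real t) x * \<xi> z x) \<le> M"
        unfolding M_def norm_mult using xi_S_le[OF t in_b] xi_bound(1)[OF in_b z]
        by (intro mult_mono) auto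
    qed simp
    also have "\<dots> \<le> (2 * R / (t + c)) * (M * pi)"
      using False M \<mu> mult_right_mono[of 1 "2 * R / (t + c)" "M * pi"] by simp
    also have "\<dots> = 2 * R * M * pi / (t + c)" by simp
    also have "\<dots> \<le> (2 + 2 * pi * R) * M / (t + c)"
      using \<mu> M by (intro divide_right_mono) (auto simp: algebra_simps)
    finally show ?thesis .
  qed
  moreover have "\<kappa> \<le> k t" unfolding \<kappa>_def by (rule k_ge[OF t])
  ultimately have "cmod (kernel_conj \<xi> pi (of_real t) z) / k t \<le> (2 + 2 * pi * R) * M / (t + c) / \<kappa>"
    using \<kappa> M R \<mu> by (intro frac_le) auto
  then show "cmod (coef t z) \<le> (2 + 2 * pi * R) * M / \<kappa> / (t + c)"
    using k_pos[of t] by (simp add: coef_def kernel_diag norm_divide mult_ac)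
qed

lemma partial_sum_cont:
  "continuous_on {0..pi} (\<lambda>x. \<Sum>t\<in>F. coef t z * \<xi> (of_real t) x)"
  by (intro continuous_intros xi_cont_pi)

lemma partial_sum_ortho:
  assumes F: "finite F" "F \<subseteq> S" "s \<in> F"
  shows "integral {0..pi} (\<lambda>x. (\<xi> z x - (\<Sum>t\<in>F. coef t z * \<xi> (of_real t) x)) * \<xi> (of_real s) x) = 0"
proof -
  have "integral {0..pi} (\<lambda>x. (\<xi> z x - (\<Sum>t\<in>F. coef t z * \<xi> (of_real t) x)) * \<xi> (of_real s) x)
     = integral {0..pi} (\<lambda>x. \<xi> z x * \<xi> (of_real s) x - (\<Sum>t\<in>F. coef t z * (\<xi> (of_real t) x * \<xi> (of_real s) x)))"
    by (simp add: left_diff_distrib sum_distrib_right mult.assoc)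
  also have "\<dots> = kernel_conj \<xi> pi z (of_real s)
      - (\<Sum>t\<in>F. coef t z * kernel_conj \<xi> pi (of_real t) (of_real s))"
    unfolding kernel_conj_def
    by (intro integral_unique has_integral_diff has_integral_sum F has_integral_mult_right
        integrable_integral integrable_continuous_real continuous_intros xi_cont_pi)
  also have "(\<Sum>t\<in>F. coef t z * kernel_conj \<xi> pi (of_real t) (of_real s))
     = (\<Sum>t\<in>F. if t = s then kernel_conj \<xi> pi (of_real s) z else 0)"
  proof (intro sum.cong refl)
    fix t assume "t \<in> F"
    then have S: "t \<in> S" "s \<in> S" using F by auto
    show "coef t z * kernel_conj \<xi> pi (of_real t) (of_real s) = (if t = s then kernel_conj \<xi> pi (of_real s) z else 0)"
    proof (cases "t = s")
      case True
      then show ?thesis using k_pos[of s] by (simp add: coef_def kernel_diag)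
    next
      case False
      have "(of_real s - of_real t) * kernel_conj \<xi> pi (of_real t) (of_real s) = 0"
        using S by (simp add: kernel_green S_def spec_neumann_def)
      then show ?thesis using False by simp
    qed
  qed
  also have "\<dots> = kernel_conj \<xi> pi (of_real s) z" using F by simp
  finally show ?thesis by (simp add: kernel_conj_def mult.commute)
qed

text \<open>The bounds on \<open>coef\<close> and on the eigenfunctions give uniform convergence to
  a continuous \<open>h\<close> by the Weierstrass test. The difference \<open>\<xi> z - h\<close>
  is orthogonal to all eigenfunctions, hence 0 by \<open>completeness\<close>.\<close>

lemma expansion:
  "uniform_limit {0..pi} (\<lambda>F x. \<Sum>t\<in>F. coef t z * \<xi> (of_real t) x) (\<xi> z) (finite_subsets_at_top S)"
proof -
  obtain C where C: "0 \<le> C"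
    "\<And>t. t \<in> S \<Longrightarrow> cmod (coef t z) \<le> C / (t + c)"
    using coef_bound[of "cmod (z + of_real c)"] by (metis norm_ge_zero order_refl)
  define M where "M = exp (B * b)"
  define P where "P = (\<lambda>F x. \<Sum>t\<in>F. coef t z * \<xi> (of_real t) x)"
  define h where "h = (\<lambda>x. \<Sum>\<^sub>\<infinity>t\<in>S. coef t z * \<xi> (of_real t) x)"
  have lim: "uniform_limit {0..pi} P h (finite_subsets_at_top S)"
    unfolding P_def h_def
  proof (rule Weierstrass_m_test_general)
    show "(\<lambda>t. (C * M) * (1 / (t + c))) summable_on S"
      by (intro summable_on_cmult_right summable_inverse)
    fix t x assume t: "t \<in> S" and "x \<in> {0..pi}"
    then have "cmod (coef t z) * cmod (\<xi> (of_real t) x) \<le> C / (t + c) * M"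
      unfolding M_def using C(1) S_ge[OF t] by (intro mult_mono C xi_S_le in_b) auto
    then show "cmod (coef t z * \<xi> (of_real t) x) \<le> (C * M) * (1 / (t + c))"
      by (simp add: norm_mult)
  qed
  have ch: "continuous_on {0..pi} h"
    by (rule uniform_limit_theorem[OF _ lim]) (auto simp: P_def intro!: partial_sum_cont)
  define \<delta> where "\<delta> = (\<lambda>x. \<xi> z x - h x)"
  have c\<delta>: "continuous_on {0..pi} \<delta>"
    unfolding \<delta>_def by (intro continuous_intros ch xi_cont_pi)
  have orth: "integral {0..pi} (\<lambda>x. \<delta> x * \<xi> (of_real s) x) = 0" if s: "s \<in> S" for s
  proof -
    have "cmod (integral {0..pi} (\<lambda>x. \<delta> x * \<xi> (of_real s) x)) \<le> 0 + e" if "e > 0" for e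
    proof -
      define e' where "e' = e / (M * pi)"
      have e': "e' > 0" using \<open>e > 0\<close> by (simp add: e'_def M_def)
      obtain X where X: "finite X" "X \<subseteq> S" "\<forall>Y. finite Y \<and> X \<subseteq> Y \<and> Y \<subseteq> S \<longrightarrow> (\<forall>x\<in>{0..pi}. dist (P Y x) (h x) < e')"
        using uniform_limitD[OF lim e'] unfolding eventually_finite_subsets_at_top by blast
      \<comment> \<open>Including \<open>s\<close> makes the remainder of the partial sum exactly
        orthogonal to the eigenfunction at \<open>s\<close>.\<close>
      define F where "F = insert s X"
      have F: "finite F" "F \<subseteq> S" "s \<in> F" using X s by (auto simp: F_def)
      have close: "\<forall>x\<in>{0..pi}. dist (P F x) (h x) < e'"
        using X(3) F by (simp add: F_def subset_insertI)
      have cP: "continuous_on {0..pi} (P F)" unfolding P_def by (rule partial_sum_cont)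
      have "integral {0..pi} (\<lambda>x. \<delta> x * \<xi> (of_real s) x)
        = integral {0..pi} (\<lambda>x. (\<xi> z x - P F x) * \<xi> (of_real s) x + (P F x - h x) * \<xi> (of_real s) x)"
        by (simp add: \<delta>_def algebra_simps)
      also have "\<dots> = integral {0..pi} (\<lambda>x. (\<xi> z x - P F x) * \<xi> (of_real s) x)
           + integral {0..pi} (\<lambda>x. (P F x - h x) * \<xi> (of_real s) x)"
        by (intro integral_add integrable_continuous_real continuous_intros cP ch xi_cont_pi)
      also have "integral {0..pi} (\<lambda>x. (\<xi> z x - P F x) * \<xi> (of_real s) x) = 0"
        unfolding P_def by (rule partial_sum_ortho[OF F])
      also have "cmod (0 + integral {0..pi} (\<lambda>x. (P F x - h x) * \<xi> (of_real s) x)) \<le> e' * M * (pi - 0)"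
        unfolding add_0
      proof (rule integral_bound)
        show "continuous_on {0..pi} (\<lambda>x. (P F x - h x) * \<xi> (of_real s) x)"
          by (intro continuous_intros cP ch xi_cont_pi)
        fix x assume x: "x \<in> {0..pi}"
        show "cmod ((P F x - h x) * \<xi> (of_real s) x) \<le> e' * M"
          unfolding norm_mult M_def using bspec[OF close x] xi_S_le[OF s in_b[OF x]] e'
          by (intro mult_mono) (auto simp: dist_norm)
      qed simp
      finally show ?thesis by (simp add: e'_def M_def)
    qed
    then have "cmod (integral {0..pi} (\<lambda>x. \<delta> x * \<xi> (of_real s) x)) \<le> 0"
      by (rule field_le_epsilon)
    then show ?thesis by simp
  qed
  have orth': "integral {0..pi} (\<lambda>x. Re (\<delta> x) * u s x) = 0" "integral {0..pi} (\<lambda>x. Im (\<delta> x) * u s x) = 0"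
    if s: "s \<in> S" for s
  proof -
    have "continuous_on {0..pi} (\<lambda>x. \<delta> x * \<xi> (of_real s) x)"
      by (intro continuous_intros c\<delta> xi_cont_pi)
    note Im_Re_integral_zero[OF this orth[OF s]]
    moreover have "integral {0..pi} (\<lambda>x. Re (\<delta> x * \<xi> (of_real s) x)) = integral {0..pi} (\<lambda>x. Re (\<delta> x) * u s x)"
      "integral {0..pi} (\<lambda>x. Im (\<delta> x * \<xi> (of_real s) x)) = integral {0..pi} (\<lambda>x. Im (\<delta> x) * u s x)"
      by (auto intro!: integral_cong simp: xi_real(1)[OF in_b])
    ultimately show "integral {0..pi} (\<lambda>x. Re (\<delta> x) * u s x) = 0" "integral {0..pi} (\<lambda>x. Im (\<delta> x) * u s x) = 0"
      by simp_all
  qed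
  have "\<delta> x = 0" if x: "x \<in> {0..pi}" for x
    using completeness[OF _ orth'(1) x] completeness[OF _ orth'(2) x] c\<delta>
    by (auto simp: complex_eq_iff intro!: continuous_intros)
  then have "h x = \<xi> z x" if "x \<in> {0..pi}" for x using that by (simp add: \<delta>_def)
  then have "uniform_limit {0..pi} P h (finite_subsets_at_top S) = uniform_limit {0..pi} P (\<xi> z) (finite_subsets_at_top S)"
    by (intro uniform_limit_cong') auto
  with lim show ?thesis by (simp add: P_def)
qed

section \<open>Convergence and error of the sampling series\<close>

text \<open>The sets of eigenvalues up to \<open>T\<close> eventually contain any given finite
  subset of \<open>S\<close>. This passes from unordered summation to the ordered partial sums of
  \<open>sampling_partial\<close>.\<close>

lemma filterlim_S_le: "filterlim (\<lambda>T. {t \<in> S. t \<le> T}) (finite_subsets_at_top S) at_top"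
  unfolding filterlim_iff
proof (intro allI impI)
  fix Q assume "eventually Q (finite_subsets_at_top S)"
  then obtain X where X: "finite X" "X \<subseteq> S" "\<forall>Y. finite Y \<and> X \<subseteq> Y \<and> Y \<subseteq> S \<longrightarrow> Q Y"
    unfolding eventually_finite_subsets_at_top by blast
  \<comment> \<open>Inserting 0 keeps \<open>Max\<close> meaningful when \<open>X\<close> is
    empty.\<close>
  have "Q {t \<in> S. t \<le> T}" if "T \<ge> Max (insert 0 X)" for T
  proof (rule X(3)[rule_format], intro conjI)
    show "X \<subseteq> {t \<in> S. t \<le> T}" using X(1,2) that by auto
  qed (auto simp: finite_S_le)
  then show "eventually (\<lambda>T. Q {t \<in> S. t \<le> T}) at_top"
    by (auto simp: eventually_at_top_linorder)
qed

text \<open>Absolute convergence: \<open>coef t z\<close> is of order \<open>1 / (t + c)\<close>,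
  and \<open>g\<close> is bounded on the spectrum because the eigenfunctions are uniformly bounded
  on \<open>[0,b]\<close>.\<close>

lemma sampling_tendsto:
  assumes \<psi>: "\<psi> absolutely_integrable_on {0..b}"
  defines "g \<equiv> \<lambda>w. integral {0..b} (\<lambda>x. \<xi> w x * \<psi> x)"
  defines "L \<equiv> \<lambda>z. \<Sum>\<^sub>\<infinity>t\<in>S. coef t z * g (of_real t)"
  shows "((\<lambda>F. \<Sum>t\<in>F. coef t z * g (of_real t)) \<longlongrightarrow> L z) (finite_subsets_at_top S)"
    and "(sampling_partial \<xi> \<xi>' g z \<longlongrightarrow> L z) at_top"
proof -
  obtain C where C: "0 \<le> C"
    "\<And>t. t \<in> S \<Longrightarrow> cmod (coef t z) \<le> C / (t + c)"
    using coef_bound[of "cmod (z + of_real c)"] by (metis norm_ge_zero order_refl)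
  define A where "A = exp (B * b) * integral {0..b} (\<lambda>x. norm (\<psi> x))"
  have gb: "cmod (g (of_real t)) \<le> A" if "t \<in> S" for t
    unfolding g_def A_def by (rule norm_integral_times_le[OF xi_cont(1) \<psi> xi_S_le[OF that]])
  have "(\<lambda>t. norm (coef t z * g (of_real t))) summable_on S"
  proof (rule summable_on_comparison_test)
    show "(\<lambda>t. (C * A) * (1 / (t + c))) summable_on S"
      by (intro summable_on_cmult_right summable_inverse)
    fix t assume t: "t \<in> S"
    have "cmod (coef t z) * cmod (g (of_real t)) \<le> C / (t + c) * A"
      using C(1) S_ge[OF t] by (intro mult_mono C gb t) auto
    then show "norm (coef t z * g (of_real t)) \<le> (C * A) * (1 / (t + c))"
      by (simp add: norm_mult)
  qed simp
  then have "((\<lambda>t. coef t z * g (of_real t)) has_sum L z) S"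
    unfolding L_def by (rule has_sum_infsum[OF abs_summable_summable])
  then show lim: "((\<lambda>F. \<Sum>t\<in>F. coef t z * g (of_real t)) \<longlongrightarrow> L z) (finite_subsets_at_top S)"
    by (simp add: has_sum_def)
  have "sampling_partial \<xi> \<xi>' g z = (\<lambda>T. \<Sum>t\<in>{t \<in> S. t \<le> T}. coef t z * g (of_real t))"
    by (simp add: fun_eq_iff sampling_partial_def S_def coef_def)
  then show "(sampling_partial \<xi> \<xi>' g z \<longlongrightarrow> L z) at_top"
    using filterlim_compose[OF lim filterlim_S_le] by simp
qed

lemma sampling_error:
  assumes R: "0 \<le> R"
  obtains D where "0 < D" and "\<And>\<psi> z. \<psi> absolutely_integrable_on {0..b} \<Longrightarrow> cmod (z + of_real c) \<le> R \<Longrightarrow>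
     cmod (integral {0..b} (\<lambda>x. \<xi> z x * \<psi> x)
        - Lim at_top (sampling_partial \<xi> \<xi>' (\<lambda>w. integral {0..b} (\<lambda>x. \<xi> w x * \<psi> x)) z))
      \<le> D * integral {pi..b} (\<lambda>x. norm (\<psi> x))"
proof -
  obtain C where C: "0 \<le> C"
    "\<And>t z. t \<in> S \<Longrightarrow> cmod (z + of_real c) \<le> R \<Longrightarrow> cmod (coef t z) \<le> C / (t + c)"
    using coef_bound[OF R] by metis
  define \<sigma> where "\<sigma> = (\<Sum>\<^sub>\<infinity>t\<in>S. 1 / (t + c))"
  define M where "M = exp (B * b)"
  \<comment> \<open>A bound on \<open>[0,b]\<close> for \<open>\<xi> z\<close> plus one for every
    finite partial sum of its expansion; it depends on \<open>R\<close> but not on \<psi>.\<close>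
  define D where "D = exp ((B + R + 2) * b) + C * \<sigma> * M"
  have \<sigma>: "(\<Sum>t\<in>F. 1 / (t + c)) \<le> \<sigma>" if "finite F" "F \<subseteq> S" for F
    unfolding \<sigma>_def using that S_ge by (intro finite_sum_le_infsum summable_inverse) force+
  have D: "0 < D" unfolding D_def M_def
    using \<sigma>[of "{}"] C(1) by (intro add_pos_nonneg) auto
  moreover have "cmod (integral {0..b} (\<lambda>x. \<xi> z x * \<psi> x)
        - Lim at_top (sampling_partial \<xi> \<xi>' (\<lambda>w. integral {0..b} (\<lambda>x. \<xi> w x * \<psi> x)) z))
      \<le> D * integral {pi..b} (\<lambda>x. norm (\<psi> x))"
    if \<psi>: "\<psi> absolutely_integrable_on {0..b}" and z: "cmod (z + of_real c) \<le> R" for \<psi> z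
  proof -
    define g where "g = (\<lambda>w. integral {0..b} (\<lambda>x. \<xi> w x * \<psi> x))"
    define L where "L = (\<Sum>\<^sub>\<infinity>t\<in>S. coef t z * g (of_real t))"
    define I where "I = integral {0..pi} (\<lambda>x. norm (\<psi> x))"
    define J where "J = integral {pi..b} (\<lambda>x. norm (\<psi> x))"
    have \<psi>1: "\<psi> absolutely_integrable_on {0..pi}" and \<psi>2: "\<psi> absolutely_integrable_on {pi..b}"
      using absolutely_integrable_on_subinterval[OF \<psi>, of 0 pi]
        absolutely_integrable_on_subinterval[OF \<psi>, of pi b] b by simp_all
    have I: "0 \<le> I" unfolding I_def
      using \<psi>1 by (intro integral_nonneg) (auto simp: absolutely_integrable_on_def)
    have int: "(\<lambda>x. q x * \<psi> x) integrable_on {0..b}" if "continuous_on {0..b} q" for q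
      using continuous_times_absolutely_integrable[OF that \<psi>] by (simp add: absolutely_integrable_on_def)
    \<comment> \<open>The error of a partial sum is the integral of \<open>q * \<psi>\<close>, where
      \<open>q\<close> is the error in expanding \<open>\<xi> z\<close>. This \<open>q\<close> is
      small on \<open>[0,pi]\<close> but merely bounded by \<open>D\<close> on
      \<open>[pi,b]\<close>.\<close>
    have bound: "cmod (g z - (\<Sum>t\<in>F. coef t z * g (of_real t))) \<le> e * I + D * J"
      if F: "finite F" "F \<subseteq> S"
        and close: "\<forall>x\<in>{0..pi}. dist (\<Sum>t\<in>F. coef t z * \<xi> (of_real t) x) (\<xi> z x) < e" for F e
    proof -
      define q where "q = (\<lambda>x. \<xi> z x - (\<Sum>t\<in>F. coef t z * \<xi> (of_real t) x))"
      have cq: "continuous_on {0..b} q" unfolding q_def by (intro continuous_intros xi_cont)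
      have cq1: "continuous_on {0..pi} q" and cq2: "continuous_on {pi..b} q"
        using continuous_on_subset[OF cq, of "{0..pi}"] continuous_on_subset[OF cq, of "{pi..b}"] b by simp_all
      have "integral {0..b} (\<lambda>x. q x * \<psi> x)
          = integral {0..b} (\<lambda>x. \<xi> z x * \<psi> x - (\<Sum>t\<in>F. coef t z * (\<xi> (of_real t) x * \<psi> x)))"
        by (simp add: q_def left_diff_distrib sum_distrib_right mult.assoc)
      also have "\<dots> = g z - (\<Sum>t\<in>F. coef t z * g (of_real t))"
        unfolding g_def
        by (intro integral_unique has_integral_diff has_integral_sum F has_integral_mult_right
            integrable_integral int xi_cont)
      finally have "g z - (\<Sum>t\<in>F. coef t z * g (of_real t)) = integral {0..b} (\<lambda>x. q x * \<psi> x)" ..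
      also have "\<dots> = integral {0..pi} (\<lambda>x. q x * \<psi> x) + integral {pi..b} (\<lambda>x. q x * \<psi> x)"
        using b by (intro Henstock_Kurzweil_Integration.integral_combine[symmetric] int cq) auto
      also have "cmod \<dots> \<le> cmod (integral {0..pi} (\<lambda>x. q x * \<psi> x)) + cmod (integral {pi..b} (\<lambda>x. q x * \<psi> x))"
        by (rule norm_triangle_ineq)
      also have "\<dots> \<le> e * I + D * J"
        unfolding I_def J_def
      proof (intro add_mono norm_integral_times_le cq1 cq2 \<psi>1 \<psi>2)
        fix x assume "x \<in> {0..pi}"
        then show "cmod (q x) \<le> e" using close by (force simp: q_def dist_norm norm_minus_commute)
      next
        fix x assume "x \<in> {pi..b}"
        then have x: "x \<in> {0..b}" using pi_ge_zero by (simp, linarith)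
        have "cmod (\<Sum>t\<in>F. coef t z * \<xi> (of_real t) x) \<le> (\<Sum>t\<in>F. C * M * (1 / (t + c)))"
        proof (rule sum_norm_le)
          fix t assume "t \<in> F"
          then have t: "t \<in> S" using F by auto
          then have "cmod (coef t z) * cmod (\<xi> (of_real t) x) \<le> C / (t + c) * M"
            unfolding M_def using C(1) S_ge[OF t] by (intro mult_mono C xi_S_le x z) auto
          then show "cmod (coef t z * \<xi> (of_real t) x) \<le> C * M * (1 / (t + c))"
            by (simp add: norm_mult)
        qed
        also have "\<dots> = C * M * (\<Sum>t\<in>F. 1 / (t + c))" by (simp add: sum_distrib_left)
        also have "\<dots> \<le> C * M * \<sigma>"
          using C(1) by (intro mult_left_mono \<sigma> F) (auto simp: M_def)
        finally show "cmod (q x) \<le> D"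
          using xi_bound(1)[OF x z] norm_triangle_ineq4[of "\<xi> z x" "\<Sum>t\<in>F. coef t z * \<xi> (of_real t) x"]
          by (simp add: D_def q_def mult_ac)
      qed
      finally show ?thesis .
    qed
    have lim: "((\<lambda>F. cmod (g z - (\<Sum>t\<in>F. coef t z * g (of_real t)))) \<longlongrightarrow> cmod (g z - L)) (finite_subsets_at_top S)"
      unfolding L_def g_def by (intro tendsto_intros sampling_tendsto(1)[OF \<psi>])
    have "cmod (g z - L) \<le> D * J + e" if "e > 0" for e
    proof (rule tendsto_upperbound[OF lim])
      \<comment> \<open>The added 1 covers the case \<open>I = 0\<close>.\<close>
      define e' where "e' = e / (I + 1)"
      have e': "e' > 0" using I \<open>e > 0\<close> by (simp add: e'_def)
      have e'I: "e' * I \<le> e" using I \<open>e > 0\<close> by (simp add: e'_def field_simps)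
      have "\<forall>\<^sub>F F in finite_subsets_at_top S. finite F \<and> F \<subseteq> S"
        by (rule eventually_finite_subsets_at_top_weakI) simp
      with uniform_limitD[OF expansion e', of z]
      show "\<forall>\<^sub>F F in finite_subsets_at_top S. cmod (g z - (\<Sum>t\<in>F. coef t z * g (of_real t))) \<le> D * J + e"
      proof (eventually_elim)
        case (elim F)
        then show ?case using bound[of F e'] e'I by simp
      qed
    qed simp
    then have "cmod (g z - L) \<le> D * J" by (rule field_le_epsilon)
    moreover have "Lim at_top (sampling_partial \<xi> \<xi>' g z) = L"
      unfolding L_def g_def by (intro tendsto_Lim sampling_tendsto(2)[OF \<psi>]) simp
    ultimately show ?thesis unfolding J_def g_def by simp
  qed
  ultimately show ?thesis by (rule that)
qed

end

section \<open>Passage from the potential to the shifted Neumann problem\<close>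

theorem theorem4p8:
  fixes b :: real and V :: "real \<Rightarrow> real"
    and \<xi> \<xi>' :: "complex \<Rightarrow> real \<Rightarrow> complex"
  assumes b: "b > pi"
    and V_ac: "abs_continuous_on 0 b V"
    and xi0: "\<And>z. \<xi> z 0 = 1"
    and xi'0: "\<And>z. \<xi>' z 0 = 0"
    and xi_deriv: "\<And>z x. x \<in> {0..b} \<Longrightarrow> (\<xi> z has_vector_derivative \<xi>' z x) (at x within {0..b})"
    and xi'_deriv: "\<And>z x. x \<in> {0..b} \<Longrightarrow>
         (\<xi>' z has_vector_derivative ((complex_of_real (V x) - z) * \<xi> z x)) (at x within {0..b})"
  shows "(\<forall>\<psi>. L2_on 0 b \<psi> \<longrightarrow> (\<forall>z. \<exists>L.
            (sampling_partial \<xi> \<xi>' (\<lambda>w. integral {0..b} (\<lambda>x. \<xi> w x * \<psi> x)) z \<longlongrightarrow> L) at_top))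
       \<and> (\<forall>K. compact K \<longrightarrow> (\<exists>D>0. \<forall>\<psi>. L2_on 0 b \<psi> \<longrightarrow> (\<forall>z\<in>K.
            cmod (integral {0..b} (\<lambda>x. \<xi> z x * \<psi> x)
                  - Lim at_top (sampling_partial \<xi> \<xi>' (\<lambda>w. integral {0..b} (\<lambda>x. \<xi> w x * \<psi> x)) z))
            \<le> D * integral {pi..b} (\<lambda>x. norm (\<psi> x)))))"
proof -
  have cV: "continuous_on {0..b} V" by (rule abs_continuous_on_imp_continuous_on[OF V_ac])
  then have "bounded (V ` {0..b})"
    by (intro compact_imp_bounded compact_continuous_image) auto
  then obtain v where "\<forall>y\<in>V ` {0..b}. norm y \<le> v"
    unfolding bounded_iff by blast
  then have v: "\<bar>V x\<bar> \<le> v" if "x \<in> {0..b}" for x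
    using that by force
  \<comment> \<open>Since \<open>V >= - v\<close> on \<open>[0,b]\<close>, this shift makes
    \<open>V + c\<close> at least 1.\<close>
  define c where "c = v + 1"
  interpret neumann_problem b c "v + c" "\<lambda>x. V x + c" \<xi> \<xi>'
  proof
    show "continuous_on {0..b} (\<lambda>x. V x + c)" by (intro continuous_intros cV)
    fix z x assume x: "x \<in> {0..b}"
    show "1 \<le> V x + c" "V x + c \<le> v + c" using v[OF x] by (auto simp: c_def)
    show "(\<xi>' z has_vector_derivative (of_real (V x + c) - (z + of_real c)) * \<xi> z x) (at x within {0..b})"
      using xi'_deriv[OF x] by simp
  qed (use b xi0 xi'0 xi_deriv in auto)
  show ?thesis
  proof (intro conjI allI impI)
    fix \<psi> z assume "L2_on 0 b \<psi>"
    then show "\<exists>L. (sampling_partial \<xi> \<xi>' (\<lambda>w. integral {0..b} (\<lambda>x. \<xi> w x * \<psi> x)) z \<longlongrightarrow> L) at_top"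
      using sampling_tendsto(2)[OF L2_on_absolutely_integrable] by blast
  next
    fix K :: "complex set" assume "compact K"
    then have "bounded ((\<lambda>z. z + of_real c) ` K)"
      by (intro compact_imp_bounded compact_continuous_image continuous_intros)
    then obtain R where "\<forall>y\<in>(\<lambda>z. z + of_real c) ` K. cmod y \<le> R"
      unfolding bounded_iff by blast
    \<comment> \<open>For empty \<open>K\<close> the bound \<open>R\<close> could be negative,
      whereas \<open>sampling_error\<close> takes a nonnegative radius.\<close>
    then have R: "cmod (z + of_real c) \<le> max 0 R" if "z \<in> K" for z
      using that by force
    obtain D where "0 < D" and D: "\<And>\<psi> z. \<psi> absolutely_integrable_on {0..b} \<Longrightarrow> cmod (z + of_real c) \<le> max 0 R \<Longrightarrow>
     cmod (integral {0..b} (\<lambda>x. \<xi> z x * \<psi> x)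
        - Lim at_top (sampling_partial \<xi> \<xi>' (\<lambda>w. integral {0..b} (\<lambda>x. \<xi> w x * \<psi> x)) z))
      \<le> D * integral {pi..b} (\<lambda>x. norm (\<psi> x))"
      using sampling_error[of "max 0 R"] by auto
    then show "\<exists>D>0. \<forall>\<psi>. L2_on 0 b \<psi> \<longrightarrow> (\<forall>z\<in>K.
            cmod (integral {0..b} (\<lambda>x. \<xi> z x * \<psi> x)
                  - Lim at_top (sampling_partial \<xi> \<xi>' (\<lambda>w. integral {0..b} (\<lambda>x. \<xi> w x * \<psi> x)) z))
            \<le> D * integral {pi..b} (\<lambda>x. norm (\<psi> x)))"
      by (intro exI[of _ D] conjI allI impI ballI D L2_on_absolutely_integrable R)
  qed
qed

end
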